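(* Let $k\geq 0$ and $n\geq k$ be integers. Then the function $R_n$ is completely monotonic of order $k$ on $(0,\infty)$. Indeed, for all $x>0$, $$R_n(x)=\int_0^\infty e^{-xt}\,r_n(t)\,dt,$$ where $r_n(t)=t^{2n}V_n(t)$ satisfies $r_n^{(l)}(0)=0$ for all integers $0\leq l\leq k-1$ and $r_n^{(k)}(t)>0$ for all $t>0$.
   Context: For an integer $n\geq 0$ the remainder $R_n:(0,\infty)\to\mathbb{R}$ is defined by $$\log\Gamma(x)=\Big(x-\frac12\Big)\log x-x+\frac12\log(2\pi)+\sum_{k=1}^{n}\frac{B_{2k}}{(2k-1)\,2k}\,\frac{1}{x^{2k-1}}+(-1)^n R_n(x),\quad x>0,$$ where $\Gamma$ is Euler's gamma function and $B_{2k}$ are the Bernoulli numbers. The function $V_n$ is defined for $t>0$ by $$\frac{t}{e^t-1}=1-\frac t2+\sum_{k=1}^{n}\frac{B_{2k}}{(2k)!}t^{2k}+(-1)^n t^{2n+2}V_n(t),$$ and equivalently $$V_n(t)=\sum_{k=1}^{\infty}\frac{2}{(t^2+4\pi^2k^2)(2\pi k)^{2n}},$$ a formula which also defines $V_n$ at $t=0$. Empty sums are zero. A function $g:(0,\infty)\to\mathbb{R}$ is completely monotonic if it has derivatives of all orders and $(-1)^m g^{(m)}(x)\geq 0$ for all $x>0$ and $m=0,1,2,\ldots$. For $r\geq 0$, a function $f$ on $(0,\infty)$ is completely monotonic of order $r$ if $x\mapsto x^r f(x)$ is completely monotonic. *)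

theory Defs
  imports "HOL-Analysis.Analysis" "HOL-Computational_Algebra.Formal_Power_Series"
begin

text \<open>Bernoulli numbers by their generating function \<open>t / (e^t - 1)\<close>, as a quotient of
  formal power series (so that the zero of \<open>e^t - 1\<close> at \<open>t = 0\<close> cancels).\<close>

definition bernoulli :: "nat \<Rightarrow> real" where
  "bernoulli k = fact k * fps_nth (fps_X / (fps_exp 1 - 1)) k"

text \<open>The defining equation of \<open>R\<^sub>n\<close>, solved for \<open>R\<^sub>n(x)\<close>; only values at \<open>x > 0\<close> are meaningful.\<close>

definition logGamma_rem :: "nat \<Rightarrow> real \<Rightarrow> real" where
  "logGamma_rem n x =
     (-1) ^ n *
       (ln (Gamma x) -
        ((x - 1 / 2) * ln x - x + 1 / 2 * ln (2 * pi)
         + (\<Sum>k = 1..n. bernoulli (2 * k) / ((2 * real k - 1) * (2 * real k))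
                          * (1 / x ^ (2 * k - 1)))))"

text \<open>For \<open>t \<noteq> 0\<close> the defining equation of \<open>V\<^sub>n\<close>, solved for \<open>V\<^sub>n(t)\<close>; at \<open>t = 0\<close> the value of
  the series \<open>\<Sum>k\<ge>1. 2 / ((t^2 + 4 \<pi>^2 k^2) (2 \<pi> k)^(2 n))\<close>, with \<open>k = Suc j\<close>.
  Only values at \<open>t \<ge> 0\<close> are meaningful.\<close>

definition V_fun :: "nat \<Rightarrow> real \<Rightarrow> real" where
  "V_fun n t =
     (if t = 0
      then (\<Sum>j. 2 / ((0\<^sup>2 + 4 * pi\<^sup>2 * (real (Suc j))\<^sup>2) * (2 * pi * real (Suc j)) ^ (2 * n)))
      else (-1) ^ n *
           (t / (exp t - 1) -
            (1 - t / 2 + (\<Sum>k = 1..n. bernoulli (2 * k) / fact (2 * k) * t ^ (2 * k))))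
           / t ^ (2 * n + 2))"

definition r_fun :: "nat \<Rightarrow> real \<Rightarrow> real" where
  "r_fun n t = t ^ (2 * n) * V_fun n t"

text \<open>The \<open>m\<close>-th derivative of \<open>f\<close> relative to \<open>S\<close>: the ordinary one at interior points of \<open>S\<close>,
  the one-sided one at an endpoint of an interval. Where a derivative does not exist the value is
  arbitrary, so assertions about values have to be accompanied by \<open>times_differentiable_on\<close>.\<close>

primrec nth_deriv_on :: "real set \<Rightarrow> nat \<Rightarrow> (real \<Rightarrow> real) \<Rightarrow> real \<Rightarrow> real" where
  "nth_deriv_on S 0 f = f"
| "nth_deriv_on S (Suc m) f = (\<lambda>x. vector_derivative (nth_deriv_on S m f) (at x within S))"

definition times_differentiable_on :: "nat \<Rightarrow> (real \<Rightarrow> real) \<Rightarrow> real set \<Rightarrow> bool" where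
  "times_differentiable_on m f S \<longleftrightarrow> (\<forall>l<m. nth_deriv_on S l f differentiable_on S)"

definition completely_monotonic :: "(real \<Rightarrow> real) \<Rightarrow> bool" where
  "completely_monotonic g \<longleftrightarrow>
     (\<forall>m. times_differentiable_on m g {0<..}) \<and>
     (\<forall>m. \<forall>x>0. (-1) ^ m * nth_deriv_on {0<..} m g x \<ge> 0)"

definition completely_monotonic_of_order :: "real \<Rightarrow> (real \<Rightarrow> real) \<Rightarrow> bool" where
  "completely_monotonic_of_order r f \<longleftrightarrow> completely_monotonic (\<lambda>x. x powr r * f x)"

end

theory Submission
  imports Defs
    "HOL-Complex_Analysis.Cauchy_Integral_Formula"
    "HOL-Real_Asymp.Real_Asymp"
begin

text \<open>
  With \<open>a\<^sub>j = 2\<pi>(j+1)\<close> and \<open>v = 1 / (1 + (t/a\<^sub>j)\<^sup>2)\<close>, the series for \<open>V\<^sub>n\<close> reads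
  \<open>r\<^sub>n(t) = t\<^bsup>2n\<^esup> \<Sum>\<^sub>j 2/a\<^sub>j\<^bsup>2n+2\<^esup> v\<close>. The Euler operator \<open>\<theta> = t d/dt\<close> maps \<open>v\<^bsup>m\<^esup>\<close> to
  \<open>-2m v\<^bsup>m\<^esup> + 2m v\<^bsup>m+1\<^esup>\<close>, and termwise
  \<open>r\<^sub>n\<^bsup>(l)\<^esup>(t) = t\<^bsup>2n-l\<^esup> \<Sum>\<^sub>j 2/a\<^sub>j\<^bsup>2n+2\<^esup> (\<theta>+2n-l+1)...(\<theta>+2n) v\<close>. These operators commute; applying
  \<open>\<theta>+2n-l+1\<close> first and \<open>\<theta>+2n\<close> last, for \<open>l \<le> n\<close> the \<open>i\<close>-th one has constant at least \<open>2i\<close>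
  when it meets a polynomial in \<open>v\<close> of degree \<open>i\<close>, so all coefficients stay nonnegative. This gives
  the positivity and the order of vanishing at \<open>0\<close>.

  The Laplace representation for \<open>n = 0\<close> is Binet's formula; the general case follows from
  \<open>V\<^sub>n(t) = V\<^sub>n(0) - t\<^sup>2 V\<^bsub>n+1\<^esub>(t)\<close>. Integrating by parts \<open>k\<close> times shows that
  \<open>x\<^bsup>k\<^esup> R\<^sub>n(x)\<close> is the Laplace transform of \<open>r\<^sub>n\<^bsup>(k)\<^esup> \<ge> 0\<close>, hence completely monotonic.
\<close>

section \<open>Series in the Lorentzian \<open>1 / (1 + (t/a)\<^sup>2)\<close>\<close>

text \<open>The nonzero poles of t/(e^t - 1) are the points \<plusminus>i \<open>freq j\<close>; the
  index is shifted so that it starts at 0.\<close>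

definition freq :: "nat \<Rightarrow> real" where
  "freq j = 2 * pi * real (Suc j)"

lemma freq_ge_Suc: "real (Suc j) \<le> freq j"
  using pi_gt3 by (simp add: freq_def mult_le_cancel_right1)

lemma freq_ge_one: "1 \<le> freq j"
  using freq_ge_Suc[of j] by simp

lemma freq_pos [simp]: "0 < freq j"
  using freq_ge_one[of j] by linarith

lemma freq_nonzero [simp]: "freq j \<noteq> 0"
  using freq_pos[of j] by linarith

lemma summable_inverse_freq_power:
  assumes "2 \<le> q"
  shows "summable (\<lambda>j. 1 / freq j ^ q)"
proof (rule summable_comparison_test')
  show "summable (\<lambda>j. 1 / real (Suc j) ^ 2)"
    using inverse_squares_sums by (simp add: sums_iff add.commute)
  fix j :: nat
  have "real (Suc j) ^ 2 \<le> freq j ^ 2"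
    by (intro power_mono freq_ge_Suc) simp
  also have "\<dots> \<le> freq j ^ q"
    using assms freq_ge_one by (intro power_increasing)
  finally show "norm (1 / freq j ^ q) \<le> 1 / real (Suc j) ^ 2"
    by (simp add: divide_simps del: of_nat_Suc)
qed

text \<open>Normalised to take values in (0, 1] for every \<open>a\<close>, so that one bound for a
  polynomial on the unit interval serves all terms of a series at once.\<close>

definition lorentz :: "real \<Rightarrow> real \<Rightarrow> real" where
  "lorentz a t = 1 / (1 + (t / a)\<^sup>2)"

lemma lorentz_denom_pos: "0 < 1 + (x::real)\<^sup>2"
  by (simp add: add_pos_nonneg)

lemma lorentz_pos: "0 < lorentz a t"
  unfolding lorentz_def by (simp add: lorentz_denom_pos)

lemma lorentz_le_one: "lorentz a t \<le> 1"
  unfolding lorentz_def by (simp add: divide_le_eq_1 lorentz_denom_pos)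

lemma lorentz_0 [simp]: "lorentz a 0 = 1"
  by (simp add: lorentz_def)

lemma lorentz_deriv:
  "(lorentz a has_real_derivative - 2 * (t / a) * (lorentz a t)\<^sup>2 / a) (at t)"
proof -
  have "1 + (t / a)\<^sup>2 \<noteq> 0" using lorentz_denom_pos[of "t/a"] by linarith
  then show ?thesis
    unfolding lorentz_def [abs_def]
    by (auto intro!: derivative_eq_intros simp: power2_eq_square divide_simps)
qed

text \<open>With u = |t/a|, the inequality 2u \<le> 1 + u^2 absorbs one factor
  \<open>lorentz a t\<close>, and the other is at most 1. Uniformity in \<open>t\<close> and
  \<open>a\<close> is what the Weierstrass test needs.\<close>

lemma lorentz_deriv_bound:
  assumes "1 \<le> a"
  shows "\<bar>- 2 * (t / a) * (lorentz a t)\<^sup>2 / a\<bar> \<le> 1"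
proof -
  define u where "u = \<bar>t / a\<bar>"
  have d: "0 < 1 + u\<^sup>2" by (rule lorentz_denom_pos)
  have "lorentz a t = 1 / (1 + u\<^sup>2)" by (simp add: lorentz_def u_def power_divide)
  then have "2 * u * lorentz a t \<le> 1"
    using d sum_squares_bound[of u 1] by simp
  then have "2 * u * lorentz a t * lorentz a t \<le> 1 * 1"
    using lorentz_pos[of a t] lorentz_le_one[of a t] by (intro mult_mono) (auto simp: less_imp_le)
  then have "2 * u * (lorentz a t)\<^sup>2 \<le> a"
    using assms by (simp add: power2_eq_square mult.assoc)
  then show ?thesis
    using assms by (simp add: abs_mult u_def divide_le_eq)
qed

text \<open>Trades the factor (t/a)^2 for a polynomial in v. Both the action of \<theta> on
  polynomials in v and the recursion for V_n rest on this.\<close>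

lemma lorentz_quotient:
  assumes "a \<noteq> 0"
  shows "(t / a)\<^sup>2 * lorentz a t = 1 - lorentz a t"
  using lorentz_denom_pos[of "t / a"] by (simp add: lorentz_def field_simps)

section \<open>Weighted series of polynomials in the Lorentzian\<close>

lemma poly_bounded_unit_interval:
  fixes Q :: "real poly"
  obtains M where "\<And>v. 0 \<le> v \<Longrightarrow> v \<le> 1 \<Longrightarrow> \<bar>poly Q v\<bar> \<le> M" and "0 \<le> M"
proof -
  have "compact (poly Q ` {0..1})"
    by (intro compact_continuous_image continuous_intros) auto
  then obtain M where "\<forall>y \<in> poly Q ` {0..1}. norm y \<le> M"
    using compact_imp_bounded bounded_iff by blast
  then have M: "\<And>v. 0 \<le> v \<Longrightarrow> v \<le> 1 \<Longrightarrow> \<bar>poly Q v\<bar> \<le> M"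
    by force
  from M[of 0] have "0 \<le> M" by simp
  with M that show thesis by blast
qed

definition lorentz_series :: "nat \<Rightarrow> real poly \<Rightarrow> real \<Rightarrow> real" where
  "lorentz_series q Q t = (\<Sum>j. 2 / freq j ^ q * poly Q (lorentz (freq j) t))"

lemma lorentz_term_bound:
  assumes "\<And>v. 0 \<le> v \<Longrightarrow> v \<le> 1 \<Longrightarrow> \<bar>poly Q v\<bar> \<le> M"
  shows "\<bar>2 / freq j ^ q * poly Q (lorentz (freq j) t)\<bar> \<le> 2 * M * (1 / freq j ^ q)"
  using assms[of "lorentz (freq j) t"] lorentz_pos[of "freq j" t] lorentz_le_one[of "freq j" t]
  by (simp add: abs_mult divide_simps less_imp_le)

lemma summable_lorentz:
  assumes "2 \<le> q"
  shows "summable (\<lambda>j. 2 / freq j ^ q * poly Q (lorentz (freq j) t))"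
proof -
  obtain M where M: "\<And>v. 0 \<le> v \<Longrightarrow> v \<le> 1 \<Longrightarrow> \<bar>poly Q v\<bar> \<le> M"
    using poly_bounded_unit_interval by blast
  show ?thesis
    by (rule summable_comparison_test'[OF
          summable_mult[OF summable_inverse_freq_power[OF assms], of "2 * M"]])
       (use lorentz_term_bound[OF M] in simp)
qed

lemma lorentz_series_bounded:
  assumes "2 \<le> q"
  obtains C where "\<And>t. \<bar>lorentz_series q Q t\<bar> \<le> C"
proof -
  obtain M where M: "\<And>v. 0 \<le> v \<Longrightarrow> v \<le> 1 \<Longrightarrow> \<bar>poly Q v\<bar> \<le> M"
    using poly_bounded_unit_interval by blast
  have "norm (lorentz_series q Q t) \<le> (\<Sum>j. 2 * M * (1 / freq j ^ q))" for t
    unfolding lorentz_series_def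
    by (rule norm_suminf_le[OF _ summable_mult[OF summable_inverse_freq_power[OF assms]]])
       (use lorentz_term_bound[OF M] in simp)
  then show thesis by (intro that) simp
qed

lemma lorentz_series_mult_poly:
  assumes "2 \<le> q"
  shows "lorentz_series q (smult c P + Q) t = c * lorentz_series q P t + lorentz_series q Q t"
proof -
  have "lorentz_series q (smult c P + Q) t
    = (\<Sum>j. c * (2 / freq j ^ q * poly P (lorentz (freq j) t)) + 2 / freq j ^ q * poly Q (lorentz (freq j) t))"
    unfolding lorentz_series_def by (intro suminf_cong) (simp only: poly_add poly_smult algebra_simps)
  also have "\<dots> = c * lorentz_series q P t + lorentz_series q Q t"
    unfolding lorentz_series_def
    using suminf_add[OF summable_mult[OF summable_lorentz[OF assms]] summable_lorentz[OF assms]]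
      suminf_mult[OF summable_lorentz[OF assms]] by metis
  finally show ?thesis .
qed

text \<open>Termwise differentiation, justified by the Weierstrass test. The derivative
  \<open>D\<close> carries the odd factor t/a^2, but \<open>t * D\<close> is again a series of the
  class, since t v' = -2v + 2v^2; hence the second conclusion is about \<open>t * D\<close>.\<close>

lemma lorentz_series_deriv:
  assumes "2 \<le> q"
  obtains D where "(lorentz_series q Q has_real_derivative D) (at t)"
    and "t * D = lorentz_series q (pderiv Q * [:0, -2, 2:]) t"
proof
  define f' where "f' j t = 2 / freq j ^ q * (poly (pderiv Q) (lorentz (freq j) t)
      * (- 2 * (t / freq j) * (lorentz (freq j) t)\<^sup>2 / freq j))" for j t
  obtain M where M: "\<And>v. 0 \<le> v \<Longrightarrow> v \<le> 1 \<Longrightarrow> \<bar>poly (pderiv Q) v\<bar> \<le> M" "0 \<le> M"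
    using poly_bounded_unit_interval by blast
  have bound: "norm (f' j t) \<le> 2 * M * (1 / freq j ^ q)" for j t
  proof -
    have "\<bar>poly (pderiv Q) (lorentz (freq j) t) * (- 2 * (t / freq j) * (lorentz (freq j) t)\<^sup>2 / freq j)\<bar>
        \<le> M * 1"
      unfolding abs_mult[of "poly _ _"]
      using M lorentz_pos[of "freq j" t] lorentz_le_one[of "freq j" t]
        lorentz_deriv_bound[OF freq_ge_one, of t j]
      by (intro mult_mono) (auto simp: less_imp_le)
    from mult_left_mono[OF this, of "2 / freq j ^ q"] show ?thesis
      unfolding f'_def real_norm_def abs_mult[of "2 / _"] by (simp add: less_imp_le)
  qed
  have "((\<lambda>x. \<Sum>j. 2 / freq j ^ q * poly Q (lorentz (freq j) x)) has_field_derivative (\<Sum>j. f' j t)) (at t)"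
  proof (rule has_field_derivative_series'(2)[where S = UNIV and ?x0.0 = 0 and f' = f'
        and f = "\<lambda>j x. 2 / freq j ^ q * poly Q (lorentz (freq j) x)"])
    show "((\<lambda>x. 2 / freq n ^ q * poly Q (lorentz (freq n) x)) has_real_derivative f' n x) (at x within UNIV)"
      for n x
      unfolding f'_def by (intro DERIV_cmult DERIV_chain2[OF poly_DERIV lorentz_deriv])
    show "uniformly_convergent_on UNIV (\<lambda>n x. \<Sum>i<n. f' i x)"
      by (rule Weierstrass_m_test'[OF bound summable_mult[OF summable_inverse_freq_power[OF assms]]])
  qed ((rule summable_lorentz[OF assms] | simp)+)
  then show "(lorentz_series q Q has_real_derivative (\<Sum>j. f' j t)) (at t)"
    unfolding lorentz_series_def [abs_def] .
  have sf: "summable (\<lambda>j. f' j t)"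
    by (rule summable_comparison_test'[OF summable_mult[OF summable_inverse_freq_power[OF assms]]])
       (rule bound)
  have "t * f' j t = 2 / freq j ^ q * poly (pderiv Q * [:0, -2, 2:]) (lorentz (freq j) t)" for j
  proof -
    have "t * (- 2 * (t / freq j) * (lorentz (freq j) t)\<^sup>2 / freq j)
        = - 2 * ((t / freq j)\<^sup>2 * lorentz (freq j) t) * lorentz (freq j) t"
      by (simp add: power2_eq_square)
    also have "\<dots> = - 2 * lorentz (freq j) t + 2 * (lorentz (freq j) t)\<^sup>2"
      unfolding lorentz_quotient[OF freq_nonzero] by (simp add: power2_eq_square algebra_simps)
    finally have *: "t * (- 2 * (t / freq j) * (lorentz (freq j) t)\<^sup>2 / freq j)
        = - 2 * lorentz (freq j) t + 2 * (lorentz (freq j) t)\<^sup>2" .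
    have "t * f' j t = 2 / freq j ^ q * (poly (pderiv Q) (lorentz (freq j) t)
      * (t * (- 2 * (t / freq j) * (lorentz (freq j) t)\<^sup>2 / freq j)))"
      unfolding f'_def by (simp only: mult_ac)
    then show ?thesis
      unfolding * by (simp add: power2_eq_square algebra_simps)
  qed
  then show "t * (\<Sum>j. f' j t) = lorentz_series q (pderiv Q * [:0, -2, 2:]) t"
    unfolding lorentz_series_def using suminf_mult[OF sf, of t] by simp
qed

lemma continuous_on_lorentz_series:
  assumes "2 \<le> q"
  shows "continuous_on A (lorentz_series q Q)"
  by (rule continuous_at_imp_continuous_on)
     (metis lorentz_series_deriv[OF assms] DERIV_isCont)

lemma lorentz_series_pos:
  assumes "2 \<le> q" and "\<And>v. 0 < v \<Longrightarrow> v \<le> 1 \<Longrightarrow> 0 < poly Q v"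
  shows "0 < lorentz_series q Q t"
  unfolding lorentz_series_def
  by (rule suminf_pos[OF summable_lorentz[OF assms(1)]])
     (use assms(2) lorentz_pos lorentz_le_one in simp)

text \<open>The action of \<open>\<theta> + c\<close> on polynomials in \<open>v\<close>.\<close>

definition euler_op :: "nat \<Rightarrow> real poly \<Rightarrow> real poly" where
  "euler_op c Q = smult (real c) Q + pderiv Q * [:0, -2, 2:]"

text \<open>Both operators are a constant plus the same linear operator \<theta>.\<close>

lemma euler_op_commute: "euler_op c (euler_op d Q) = euler_op d (euler_op c Q)"
proof -
  have *: "pderiv (smult a P + R) * S = smult a (pderiv P * S) + pderiv R * S" for a and P R S :: "real poly"
    by (simp add: pderiv_add pderiv_smult distrib_right)
  show ?thesis
    unfolding euler_op_def * by (simp add: smult_add_right add_ac mult.commute)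
qed

section \<open>Positivity of coefficients under the Euler operators\<close>

lemma coeff_mult_quadratic:
  "coeff (P * [:0, -2, 2:]) i
    = - 2 * (if i < 1 then 0 else coeff P (i - 1)) + (2::real) * (if i < 2 then 0 else coeff P (i - 2))"
proof (cases i)
  case 0
  then show ?thesis by (simp add: coeff_mult)
next
  case (Suc k)
  then show ?thesis by (cases k) (auto simp: coeff_pCons mult.commute[of P])
qed

text \<open>Read off from \<theta> v^i = -2i v^i + 2i v^(i+1): the diagonal contributes c - 2i, and
  the coefficient below contributes 2(i - 1). The case \<open>i = 0\<close> guards the truncated
  subtraction.\<close>

lemma coeff_euler_op:
  "coeff (euler_op c Q) i = (real c - 2 * real i) * coeff Q i + 2 * (real i - 1) * (if i = 0 then 0 else coeff Q (i - 1))"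
proof (cases i)
  case 0
  then show ?thesis by (simp add: euler_op_def coeff_mult_quadratic)
next
  case (Suc k)
  then show ?thesis by (cases k) (auto simp: euler_op_def coeff_mult_quadratic coeff_pderiv algebra_simps)
qed

text \<open>The index \<open>m\<close> is the exact degree: the vanishing above \<open>m\<close>
  limits which factors c - 2i matter, and the positive leading coefficient yields strict
  positivity.\<close>

definition nonneg_poly :: "nat \<Rightarrow> real poly \<Rightarrow> bool" where
  "nonneg_poly m Q \<longleftrightarrow> (\<forall>i. 0 \<le> coeff Q i) \<and> (\<forall>i>m. coeff Q i = 0) \<and> 0 < coeff Q m"

text \<open>Only the factor c - 2i could be negative, and it meets a nonzero coefficient only for i
  \<le> m, where 2i \<le> 2m \<le> c. The new leading coefficient is 2m times the old one, hence
  positive because m \<ge> 1.\<close>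

lemma nonneg_poly_euler_op:
  assumes "nonneg_poly m Q" "1 \<le> m" "2 * m \<le> c"
  shows "nonneg_poly (Suc m) (euler_op c Q)"
  unfolding nonneg_poly_def
proof (intro conjI allI impI)
  fix i
  have 1: "0 \<le> coeff Q j" for j using assms(1) by (auto simp: nonneg_poly_def)
  have 2: "coeff Q j = 0" if "m < j" for j using assms(1) that by (auto simp: nonneg_poly_def)
  show "0 \<le> coeff (euler_op c Q) i"
  proof -
    have "0 \<le> (real c - 2 * real i) * coeff Q i"
      using 1[of i] 2[of i] assms(3) by (cases "i \<le> m") auto
    moreover have "0 \<le> 2 * (real i - 1) * (if i = 0 then 0 else coeff Q (i - 1))"
      using 1[of "i - 1"] by auto
    ultimately show ?thesis unfolding coeff_euler_op by linarith
  qed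
  show "coeff (euler_op c Q) i = 0" if "Suc m < i"
    using that by (simp add: coeff_euler_op 2)
  show "0 < coeff (euler_op c Q) (Suc m)"
    using assms by (simp add: coeff_euler_op 2 nonneg_poly_def)
qed

lemma nonneg_poly_pos:
  assumes "nonneg_poly m Q" "0 < v"
  shows "0 < poly Q v"
proof -
  have "coeff Q m * v ^ m \<le> (\<Sum>i\<le>degree Q. coeff Q i * v ^ i)"
    using assms by (intro member_le_sum) (auto simp: nonneg_poly_def intro!: le_degree)
  moreover have "0 < coeff Q m * v ^ m" using assms by (simp add: nonneg_poly_def)
  ultimately show ?thesis by (simp add: poly_altdef)
qed

text \<open>This is (\<theta> + c)(\<theta> + c + 1)...(\<theta> + c + j - 1) v. The smallest
  constant is outermost, which is the order in which successive differentiations produce the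
  factors.\<close>

primrec euler_chain :: "nat \<Rightarrow> nat \<Rightarrow> real poly" where
  "euler_chain 0 c = [:0, 1:]"
| "euler_chain (Suc j) c = euler_op c (euler_chain j (Suc c))"

text \<open>By commutation the largest constant may be applied last, when the degree is largest;
  this order suits the positivity argument.\<close>

lemma euler_chain_Suc_right: "euler_chain (Suc j) c = euler_op (c + j) (euler_chain j c)"
proof (induction j arbitrary: c)
  case (Suc j)
  have "euler_chain (Suc (Suc j)) c = euler_op c (euler_op (Suc c + j) (euler_chain j (Suc c)))"
    using Suc.IH[of "Suc c"] by simp
  then show ?case by (simp add: euler_op_commute[of c])
qed simp

text \<open>In the induction step the constant \<open>c + j\<close> meets a polynomial of degree
  \<open>Suc j\<close>, so 2(j + 1) \<le> c + j is required, which is exactly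
  \<open>Suc j < c\<close>.\<close>

lemma nonneg_poly_euler_chain:
  assumes "j < c"
  shows "nonneg_poly (Suc j) (euler_chain j c)"
  using assms
proof (induction j)
  case 0
  show ?case by (auto simp: nonneg_poly_def coeff_pCons split: nat.splits)
next
  case (Suc j)
  then show ?case
    unfolding euler_chain_Suc_right by (intro nonneg_poly_euler_op) auto
qed

text \<open>Product rule in the form (t^(p+1) f)' = t^p ((p + 1) f + t f'): a differentiation lowers
  the power by one and applies \<theta> + p + 1 to the polynomial.\<close>

lemma power_lorentz_series_deriv:
  assumes "2 \<le> q"
  shows "((\<lambda>t. t ^ Suc p * lorentz_series q Q t) has_real_derivative
      t ^ p * lorentz_series q (euler_op (Suc p) Q) t) (at t)"
proof -
  obtain D where D: "(lorentz_series q Q has_real_derivative D) (at t)"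
    "t * D = lorentz_series q (pderiv Q * [:0, -2, 2:]) t"
    using lorentz_series_deriv[OF assms] by blast
  show ?thesis
    unfolding euler_op_def lorentz_series_mult_poly[OF assms] D(2)[symmetric]
    by (rule derivative_eq_intros D(1) refl)+ (simp add: algebra_simps)
qed

section \<open>Partial fractions and Bernoulli numbers\<close>

text \<open>Euler's product for the sine at the imaginary point z = it/(2\<pi>), where sin(\<pi>z) =
  i sinh(t/2).\<close>

lemma sinh_product:
  fixes t :: real
  assumes "0 < t"
  shows "(\<lambda>n. \<Prod>k<n. 1 + (t / freq k)\<^sup>2) \<longlonglongrightarrow> sinh (t / 2) / (t / 2)"
proof -
  define z where "z = \<i> * complex_of_real (t / (2 * pi))"
  have sin: "sin (complex_of_real pi * z) = \<i> * complex_of_real (sinh (t / 2))"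
  proof -
    have "complex_of_real pi * z = \<i> * complex_of_real (t / 2)"
      by (simp add: z_def)
    moreover have "sinh (complex_of_real x) = complex_of_real (sinh x)" for x
      by (simp add: sinh_field_def exp_of_real flip: of_real_minus)
    ultimately show ?thesis
      by (simp only: sin_conv_sinh mult.assoc[symmetric] i_squared) (simp flip: of_real_divide)
  qed
  have factor: "1 - z\<^sup>2 / (of_nat (Suc k))\<^sup>2 = complex_of_real (1 + (t / freq k)\<^sup>2)" for k
    by (simp add: z_def freq_def power_mult_distrib power_divide)
  have "(\<lambda>n. complex_of_real pi * z * (\<Prod>k=1..n. 1 - z\<^sup>2 / (of_nat k)\<^sup>2)) \<longlonglongrightarrow> \<i> * complex_of_real (sinh (t / 2))"
    using sin_product_formula_complex[of z] unfolding sin .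
  also have "(\<lambda>n. complex_of_real pi * z * (\<Prod>k=1..n. 1 - z\<^sup>2 / (of_nat k)\<^sup>2))
      = (\<lambda>n. \<i> * complex_of_real (t / 2 * (\<Prod>k<n. 1 + (t / freq k)\<^sup>2)))"
    unfolding One_nat_def prod.atLeast1_atMost_eq factor by (simp add: z_def mult.assoc)
  finally have "(\<lambda>n. \<i> * complex_of_real (t / 2 * (\<Prod>k<n. 1 + (t / freq k)\<^sup>2)))
      \<longlonglongrightarrow> \<i> * complex_of_real (sinh (t / 2))" .
  from tendsto_Im[OF this]
  have "(\<lambda>n. t / 2 * (\<Prod>k<n. 1 + (t / freq k)\<^sup>2)) \<longlonglongrightarrow> sinh (t / 2)"
    by (simp only: Im_i_times Re_complex_of_real)
  from tendsto_divide[OF this tendsto_const[of "t / 2"]] assms show ?thesis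
    by simp
qed

lemma ln_sinh_sums:
  fixes t :: real
  assumes "0 < t"
  shows "(\<lambda>j. ln (1 + (t / freq j)\<^sup>2)) sums ln (sinh (t / 2) / (t / 2))"
proof -
  have "(\<lambda>n. ln (\<Prod>k<n. 1 + (t / freq k)\<^sup>2)) \<longlonglongrightarrow> ln (sinh (t / 2) / (t / 2))"
    using assms by (intro tendsto_ln[OF sinh_product]) auto
  moreover have "ln (\<Prod>k<n. 1 + (t / freq k)\<^sup>2) = (\<Sum>k<n. ln (1 + (t / freq k)\<^sup>2))" for n
    by (intro ln_prod finite_lessThan) (metis lorentz_denom_pos less_irrefl)
  ultimately show ?thesis by (simp add: sums_def)
qed

text \<open>The series for V_n with k = j + 1. One formula covers all real \<open>t\<close>, without
  the case distinction in \<open>V_fun\<close>.\<close>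

definition V_series :: "nat \<Rightarrow> real \<Rightarrow> real" where
  "V_series n = lorentz_series (2 * n + 2) [:0, 1:]"

lemma V_series_sums: "(\<lambda>j. 2 / freq j ^ (2 * n + 2) * lorentz (freq j) t) sums V_series n t"
  using summable_sums[OF summable_lorentz[of "2 * n + 2" "[:0, 1:]" t]]
  by (simp add: V_series_def lorentz_series_def)

text \<open>Logarithmic derivative of the product for sinh: ln(sinh(t/2)/(t/2)) is differentiated
  once through its series and once in closed form.\<close>

lemma coth_partial_fractions:
  fixes t :: real
  assumes "0 < t"
  shows "t * V_series 0 t = cosh (t / 2) / (2 * sinh (t / 2)) - 1 / t"
proof -
  have sh: "0 < sinh (t / 2)" using assms by simp
  let ?f' = "\<lambda>j x. 2 * x / (freq j)\<^sup>2 * lorentz (freq j) x"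
  have "((\<lambda>x. \<Sum>j. ln (1 + (x / freq j)\<^sup>2)) has_field_derivative (\<Sum>j. ?f' j t)) (at t)"
  \<comment> \<open>A bounded interval around \<open>t\<close> makes the factor x in the derived
    terms harmless: they are dominated by 2(t + 1)/a^2.\<close>
  proof (rule has_field_derivative_series'(2)[where S = "{0<..<t + 1}" and ?x0.0 = t and f' = ?f'])
    show "((\<lambda>x. ln (1 + (x / freq n)\<^sup>2)) has_real_derivative ?f' n x) (at x within {0<..<t + 1})"
      for n x
      using lorentz_denom_pos[of "x / freq n"] unfolding lorentz_def
      by (auto intro!: derivative_eq_intros simp: power2_eq_square)
    show "uniformly_convergent_on {0<..<t + 1} (\<lambda>n x. \<Sum>i<n. ?f' i x)"
    proof (rule Weierstrass_m_test')
      show "summable (\<lambda>j. 2 * (t + 1) * (1 / freq j ^ 2))"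
        by (intro summable_mult summable_inverse_freq_power) simp
      show "norm (?f' j x) \<le> 2 * (t + 1) * (1 / freq j ^ 2)" if "x \<in> {0<..<t + 1}" for j x
      proof -
        have "2 * x * lorentz (freq j) x \<le> 2 * (t + 1) * 1"
          using that lorentz_le_one lorentz_pos[of "freq j" x] by (intro mult_mono) auto
        then show ?thesis
          using that lorentz_pos[of "freq j" x] by (simp add: abs_mult divide_right_mono)
      qed
    qed
  qed (use assms ln_sinh_sums[OF assms] in \<open>auto simp: sums_iff\<close>)
  moreover have "(\<Sum>j. ?f' j t) = t * V_series 0 t"
  proof -
    have "(\<lambda>j. t * (2 / freq j ^ 2 * lorentz (freq j) t)) sums (t * V_series 0 t)"
      using sums_mult[OF V_series_sums[of 0 t], of t] by (simp only: mult_0_right add_0)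
    then show ?thesis by (simp add: sums_iff mult_ac)
  qed
  ultimately have "((\<lambda>x. \<Sum>j. ln (1 + (x / freq j)\<^sup>2)) has_field_derivative t * V_series 0 t) (at t)"
    by simp
  moreover have "\<forall>\<^sub>F x in nhds t. (\<Sum>j. ln (1 + (x / freq j)\<^sup>2)) = ln (sinh (x / 2) / (x / 2))"
    using eventually_nhds_in_open[of "{0<..}" t] assms
    by (auto elim!: eventually_mono dest: ln_sinh_sums simp: sums_iff)
  ultimately have "((\<lambda>x. ln (sinh (x / 2) / (x / 2))) has_field_derivative t * V_series 0 t) (at t)"
    by (simp cong: DERIV_cong_ev)
  moreover have "((\<lambda>x. ln (sinh (x / 2) / (x / 2))) has_field_derivative
      cosh (t / 2) / (2 * sinh (t / 2)) - 1 / t) (at t)"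
    using assms sh by (auto intro!: derivative_eq_intros simp: field_simps)
  ultimately show ?thesis by (rule DERIV_unique)
qed

text \<open>Multiplied out so that t = 0 is included. Positive \<open>t\<close> follows from the
  partial fractions of coth; negative \<open>t\<close> is reduced to it by the evenness of
  \<open>V_series 0\<close> and multiplication by e^t.\<close>

lemma exp_quotient_eq_V_series:
  fixes t :: real
  shows "(1 - t / 2 + t\<^sup>2 * V_series 0 t) * (exp t - 1) = t"
proof -
  have pos: "(1 - t / 2 + t\<^sup>2 * V_series 0 t) * (exp t - 1) = t" if "0 < t" for t
  proof -
    have "t\<^sup>2 * V_series 0 t = t * (t * V_series 0 t)"
      by (simp add: power2_eq_square)
    also have "\<dots> = t * (cosh (t / 2) / (2 * sinh (t / 2))) - 1"
      unfolding coth_partial_fractions[OF that] using that by (simp add: right_diff_distrib)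
    also have "cosh (t / 2) / (2 * sinh (t / 2)) = (exp t + 1) / (2 * (exp t - 1))"
    proof -
      have "exp t = exp (t / 2) * exp (t / 2)" by (simp flip: exp_add)
      moreover have "1 < exp (t / 2)" using that by simp
      ultimately show ?thesis
        by (simp add: cosh_field_def sinh_field_def exp_minus divide_simps)
    qed
    finally show ?thesis using that by (simp add: field_simps)
  qed
  have even: "V_series 0 (- t) = V_series 0 t"
    by (simp add: V_series_def lorentz_series_def lorentz_def)
  consider "0 < t" | "t = 0" | "t < 0" by linarith
  then show ?thesis
  proof cases
    case 3
    have "(1 + t / 2 + t\<^sup>2 * V_series 0 t) * (exp (- t) - 1) = - t"
      using pos[of "- t"] 3 even by simp
    then have "((1 + t / 2 + t\<^sup>2 * V_series 0 t) * (exp (- t) - 1)) * exp t = - t * exp t"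
      by simp
    moreover have "(exp (- t) - 1) * exp t = 1 - exp t"
      by (simp add: algebra_simps flip: exp_add)
    ultimately have "(1 + t / 2 + t\<^sup>2 * V_series 0 t) * (1 - exp t) = - t * exp t"
      by (simp add: mult.assoc)
    then show ?thesis by (simp add: field_simps)
  qed (use pos in auto)
qed

section \<open>Taylor expansion at 0 and the Bernoulli numbers\<close>

text \<open>Term by term this is v = 1 - (t/a)^2 v.\<close>

lemma V_series_recursion: "V_series n t = V_series n 0 - t\<^sup>2 * V_series (Suc n) t"
proof (rule sums_unique2[OF V_series_sums])
  have "(\<lambda>j. 2 / freq j ^ (2 * n + 2) * lorentz (freq j) 0
        - t\<^sup>2 * (2 / freq j ^ (2 * Suc n + 2) * lorentz (freq j) t))
      sums (V_series n 0 - t\<^sup>2 * V_series (Suc n) t)"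
    by (intro sums_diff sums_mult V_series_sums)
  moreover have "2 / freq j ^ (2 * n + 2) * lorentz (freq j) 0
        - t\<^sup>2 * (2 / freq j ^ (2 * Suc n + 2) * lorentz (freq j) t)
      = 2 / freq j ^ (2 * n + 2) * lorentz (freq j) t" for j
  proof -
    have "t\<^sup>2 * (2 / freq j ^ (2 * Suc n + 2) * lorentz (freq j) t)
        = 2 / freq j ^ (2 * n + 2) * ((t / freq j)\<^sup>2 * lorentz (freq j) t)"
      by (simp add: power_divide power2_eq_square mult_ac)
    then show ?thesis
      unfolding lorentz_quotient[OF freq_nonzero] by (simp only: right_diff_distrib lorentz_0)
  qed
  ultimately show "(\<lambda>j. 2 / freq j ^ (2 * n + 2) * lorentz (freq j) t)
      sums (V_series n 0 - t\<^sup>2 * V_series (Suc n) t)" by simp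
qed

text \<open>The recursion iterated \<open>n\<close> times, with an exact remainder that has the same
  sign pattern as in the definition of V_n.\<close>

lemma V_series_expansion:
  "t\<^sup>2 * V_series 0 t = (\<Sum>k<n. (-1) ^ k * V_series k 0 * t ^ (2 * k + 2)) + (-1) ^ n * t ^ (2 * n + 2) * V_series n t"
proof (induction n)
  case (Suc n)
  show ?case
    unfolding Suc.IH by (subst V_series_recursion) (simp add: power2_eq_square algebra_simps)
qed (simp add: power2_eq_square)

text \<open>The upper bound is uniform in \<open>n\<close> because every frequency is at least 1; it
  makes the Taylor remainder tend to 0 for |t| < 1.\<close>

lemma V_series_bounds: "0 \<le> V_series n t" "V_series n t \<le> V_series 0 0"
proof -
  show "0 \<le> V_series n t"
    by (rule sums_le[OF _ sums_zero V_series_sums]) (use lorentz_pos in \<open>auto simp: less_imp_le\<close>)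
  show "V_series n t \<le> V_series 0 0"
  proof (rule sums_le[OF _ V_series_sums V_series_sums])
    fix j
    have "2 / freq j ^ (2 * n + 2) \<le> 2 / freq j ^ (2 * 0 + 2)"
      using freq_ge_one[of j] by (intro divide_left_mono power_increasing) auto
    then show "2 / freq j ^ (2 * n + 2) * lorentz (freq j) t
        \<le> 2 / freq j ^ (2 * 0 + 2) * lorentz (freq j) 0"
      using lorentz_le_one[of "freq j" t] lorentz_pos[of "freq j" t] by (intro mult_mono) auto
  qed
qed

lemma V_series_taylor_sums:
  assumes "\<bar>t\<bar> < 1"
  shows "(\<lambda>k. (-1) ^ k * V_series k 0 * t ^ (2 * k + 2)) sums (t\<^sup>2 * V_series 0 t)"
proof -
  have "(\<lambda>n. (-1) ^ n * t ^ (2 * n + 2) * V_series n t) \<longlonglongrightarrow> 0"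
  proof (rule Lim_null_comparison)
    have "(\<lambda>n. (t\<^sup>2) ^ Suc n) \<longlonglongrightarrow> 0"
      using assms by (intro LIMSEQ_Suc LIMSEQ_power_zero) (simp add: abs_square_less_1)
    from tendsto_mult_right[OF this, of "V_series 0 0"]
    show "(\<lambda>n. (t\<^sup>2) ^ Suc n * V_series 0 0) \<longlonglongrightarrow> 0" by simp
    have "norm ((-1) ^ n * t ^ (2 * n + 2) * V_series n t) \<le> (t\<^sup>2) ^ Suc n * V_series 0 0" for n
    proof -
      have "t ^ (2 * n + 2) = (t\<^sup>2) ^ Suc n" by (simp only: power_mult[symmetric]) simp
      then show ?thesis
        using V_series_bounds[of n t] by (simp add: abs_mult power_abs mult_left_mono)
    qed
    then show "\<forall>\<^sub>F n in sequentially. norm ((-1) ^ n * t ^ (2 * n + 2) * V_series n t) \<le> (t\<^sup>2) ^ Suc n * V_series 0 0"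
      by (rule always_eventually[OF allI])
  qed
  from tendsto_diff[OF tendsto_const[of "t\<^sup>2 * V_series 0 t"] this]
  have "(\<lambda>n. t\<^sup>2 * V_series 0 t - (-1) ^ n * t ^ (2 * n + 2) * V_series n t) \<longlonglongrightarrow> t\<^sup>2 * V_series 0 t"
    by simp
  moreover have "t\<^sup>2 * V_series 0 t - (-1) ^ n * t ^ (2 * n + 2) * V_series n t
      = (\<Sum>k<n. (-1) ^ k * V_series k 0 * t ^ (2 * k + 2))" for n
    using V_series_expansion[of t n] by linarith
  ultimately show ?thesis by (simp add: sums_def)
qed

text \<open>Zeros of a nonzero convergent power series are isolated.\<close>

lemma has_fps_expansion_0_imp_eq_0:
  fixes F :: "real fps"
  assumes "(\<lambda>_. 0) has_fps_expansion F"
  shows "F = 0"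
proof (rule ccontr)
  assume "F \<noteq> 0"
  have rad: "0 < fps_conv_radius F" and ev: "\<forall>\<^sub>F z in nhds 0. eval_fps F z = 0"
    using assms by (auto simp: has_fps_expansion_def)
  from ev obtain e where e: "0 < e" "\<And>z. norm z < e \<Longrightarrow> eval_fps F z = 0"
    by (auto simp: eventually_nhds_metric dist_norm)
  from rad obtain r where r: "0 < r" "ereal r \<le> fps_conv_radius F"
    using ereal_dense2[OF rad] by (auto simp: zero_ereal_def less_imp_le)
  have sums: "(\<lambda>n. fps_nth F n * (x - 0) ^ n) sums 0" if "norm (x - 0) < min e r" for x
  proof -
    have "summable (\<lambda>n. fps_nth F n * x ^ n)"
      using that r(2) by (intro summable_fps less_le_trans[OF _ r(2)]) simp
    with e(2)[of x] that show ?thesis by (simp add: eval_fps_def sums_iff)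
  qed
  \<comment> \<open>Isolation of zeros is applied through a nonzero coefficient of positive index,
    so the constant coefficient is settled first.\<close>
  have "fps_nth F 0 = 0"
    using e(2)[of 0] e(1) by (simp add: eval_fps_at_0)
  obtain m where m: "fps_nth F m \<noteq> 0" using \<open>F \<noteq> 0\<close> by (auto simp: fps_eq_iff)
  with \<open>fps_nth F 0 = 0\<close> have "0 < m" by (cases m) auto
  obtain s where s: "0 < s" "\<And>z::real. z \<in> cball 0 s - {0} \<Longrightarrow> (0::real) \<noteq> 0"
    by (rule powser_0_nonzero[of "min e r" 0 "fps_nth F" "\<lambda>_. 0" m])
       (use sums e(1) r(1) m \<open>0 < m\<close> in auto)
  from s(2)[of s] s(1) show False by simp
qed

text \<open>The identity (1 - t/2 + t^2 V_0(t))(e^t - 1) = t carries over to formal power series by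
  uniqueness of expansions; there e^X - 1 is cancelled and coefficients are compared.\<close>

lemma bernoulli_eq_V_series:
  "bernoulli (2 * Suc k) / fact (2 * Suc k) = (-1) ^ k * V_series k 0"
proof -
  \<comment> \<open>The expansion of t^2 V_0(t): only the even positive indices m = 2j + 2 occur,
    and j is recovered as \<open>m div 2 - 1\<close>.\<close>
  define B :: "real fps" where
    "B = Abs_fps (\<lambda>m. if even m \<and> m \<noteq> 0 then (-1) ^ (m div 2 - 1) * V_series (m div 2 - 1) 0 else 0)"
  have B_nth: "fps_nth B (2 * j + 2) = (-1) ^ j * V_series j 0" for j
    by (simp add: B_def)
  have B_sums: "(\<lambda>m. fps_nth B m * t ^ m) sums (t\<^sup>2 * V_series 0 t)" if "\<bar>t\<bar> < 1" for t
  proof -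
    have "(\<lambda>j. fps_nth B (2 * j + 2) * t ^ (2 * j + 2)) sums (t\<^sup>2 * V_series 0 t)"
      using V_series_taylor_sums[OF that] unfolding B_nth .
    moreover have "strict_mono (\<lambda>j::nat. 2 * j + 2)"
      by (simp add: strict_mono_def)
    moreover have "fps_nth B m * t ^ m = 0" if "m \<notin> range (\<lambda>j. 2 * j + 2)" for m
    proof -
      have "\<not> (even m \<and> m \<noteq> 0)"
      proof
        assume "even m \<and> m \<noteq> 0"
        then have "m = 2 * (m div 2 - 1) + 2" by auto
        with that show False by blast
      qed
      then show ?thesis by (auto simp: B_def)
    qed
    ultimately show ?thesis
      using sums_mono_reindex[of "\<lambda>j. 2 * j + 2" "\<lambda>m. fps_nth B m * t ^ m"] by blast
  qed
  have "ereal (1 / 2) \<le> fps_conv_radius B"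
    using conv_radius_geI[OF sums_summable[OF B_sums[of "1 / 2"]]]
    by (simp add: fps_conv_radius_def)
  then have rad: "0 < fps_conv_radius B"
    by (rule less_le_trans[rotated]) simp
  have "\<forall>\<^sub>F t in nhds 0. eval_fps B t = t\<^sup>2 * V_series 0 t"
    unfolding eventually_nhds_metric
    by (rule exI[of _ 1]) (use B_sums in \<open>auto simp: eval_fps_def sums_iff dist_norm\<close>)
  with rad have [fps_expansion_intros]: "(\<lambda>t. t\<^sup>2 * V_series 0 t) has_fps_expansion B"
    by (simp add: has_fps_expansion_def)
  have "(\<lambda>t::real. (1 - t * (1 / 2) + t\<^sup>2 * V_series 0 t) * (exp (1 * t) - 1) - t) has_fps_expansion
      (1 - fps_X * fps_const (1 / 2) + B) * (fps_exp 1 - 1) - fps_X"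
    by (intro fps_expansion_intros)
  moreover have "(1 - t * (1 / 2) + t\<^sup>2 * V_series 0 t) * (exp (1 * t) - 1) - t = 0" for t :: real
    using exp_quotient_eq_V_series[of t] by simp
  ultimately have "(1 - fps_X * fps_const (1 / 2) + B) * (fps_exp 1 - 1) - fps_X = 0"
    by (intro has_fps_expansion_0_imp_eq_0) simp
  then have "fps_X = (1 - fps_X * fps_const (1 / 2) + B) * (fps_exp 1 - 1)" by simp
  moreover have "fps_exp (1::real) - 1 \<noteq> 0"
    by (auto simp: fps_eq_iff intro!: exI[of _ 1])
  ultimately have "fps_X / (fps_exp 1 - 1) = 1 - fps_X * fps_const (1 / 2) + B"
    by (metis nonzero_mult_div_cancel_right)
  then show ?thesis
    using B_nth[of k] by (simp add: bernoulli_def)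
qed

text \<open>For t > 0 the Bernoulli sum is the Taylor sum of t^2 V_0(t), so the bracket in
  \<open>V_fun\<close> is the exact remainder; at t = 0 both sides are the same series.\<close>

lemma V_fun_eq_V_series:
  assumes "0 \<le> t"
  shows "V_fun n t = V_series n t"
proof (cases "t = 0")
  case True
  have "(\<lambda>j. 2 / freq j ^ (2 * n + 2) * lorentz (freq j) 0)
      = (\<lambda>j. 2 / ((0\<^sup>2 + 4 * pi\<^sup>2 * (real (Suc j))\<^sup>2) * (2 * pi * real (Suc j)) ^ (2 * n)))"
  proof
    fix j
    have "freq j ^ (2 * n + 2) = (0\<^sup>2 + 4 * pi\<^sup>2 * (real (Suc j))\<^sup>2) * (2 * pi * real (Suc j)) ^ (2 * n)"
      unfolding power_add freq_def by (simp add: power_mult_distrib)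
    then show "2 / freq j ^ (2 * n + 2) * lorentz (freq j) 0
        = 2 / ((0\<^sup>2 + 4 * pi\<^sup>2 * (real (Suc j))\<^sup>2) * (2 * pi * real (Suc j)) ^ (2 * n))"
      by simp
  qed
  with V_series_sums[of n 0] True show ?thesis
    by (simp add: V_fun_def sums_iff)
next
  case False
  with assms have t: "0 < t" by simp
  have "t / (exp t - 1) = 1 - t / 2 + t\<^sup>2 * V_series 0 t"
    using exp_quotient_eq_V_series[of t] t by (simp add: field_simps)
  moreover have "(\<Sum>k = 1..n. bernoulli (2 * k) / fact (2 * k) * t ^ (2 * k))
      = (\<Sum>k<n. (-1) ^ k * V_series k 0 * t ^ (2 * k + 2))"
    unfolding One_nat_def sum.atLeast1_atMost_eq bernoulli_eq_V_series by simp
  ultimately have "V_fun n t = (-1) ^ n * ((-1) ^ n * t ^ (2 * n + 2) * V_series n t) / t ^ (2 * n + 2)"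
    using False V_series_expansion[of t n] by (simp add: V_fun_def)
  then show ?thesis using False by simp
qed

section \<open>Laplace transforms of functions of subexponential growth\<close>

text \<open>Growth slower than every exponential gives Laplace integrals convergent at every x > 0.
  The class is closed under products, in particular with powers of t, as differentiation of
  transforms requires.\<close>

definition subexp :: "(real \<Rightarrow> real) \<Rightarrow> bool" where
  "subexp h \<longleftrightarrow> continuous_on {0..} h \<and> (\<forall>d>0. \<exists>C. \<forall>t\<ge>0. \<bar>h t\<bar> \<le> C * exp (d * t))"

lemma subexpE:
  assumes "subexp h" "0 < d"
  obtains C where "0 \<le> C" "\<And>t. 0 \<le> t \<Longrightarrow> \<bar>h t\<bar> \<le> C * exp (d * t)"
proof -
  from assms obtain C where C: "\<And>t. 0 \<le> t \<Longrightarrow> \<bar>h t\<bar> \<le> C * exp (d * t)"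
    by (auto simp: subexp_def)
  from C[of 0] have "0 \<le> C" by simp
  with C that show thesis by blast
qed

lemma subexp_continuous: "subexp h \<Longrightarrow> continuous_on {0..} h"
  by (simp add: subexp_def)

lemma subexp_bounded:
  assumes "continuous_on {0..} h" "\<And>t. 0 \<le> t \<Longrightarrow> \<bar>h t\<bar> \<le> C"
  shows "subexp h"
  unfolding subexp_def
proof (intro conjI allI impI exI)
  fix d t :: real
  assume "0 < d" "0 \<le> t"
  then have "1 \<le> exp (d * t)" by simp
  moreover have "0 \<le> C" using assms(2)[of 0] by simp
  ultimately have "C * 1 \<le> C * exp (d * t)" by (intro mult_left_mono)
  with assms(2)[OF \<open>0 \<le> t\<close>] show "\<bar>h t\<bar> \<le> C * exp (d * t)" by simp
qed (rule assms(1))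

lemma subexp_const: "subexp (\<lambda>_. c)"
  by (rule subexp_bounded[where C = "\<bar>c\<bar>"]) auto

lemma subexp_id: "subexp (\<lambda>t. t)"
  unfolding subexp_def
proof (intro conjI allI impI exI)
  fix d t :: real
  assume d: "0 < d" and t: "0 \<le> t"
  have "d * t \<le> exp (d * t)" using exp_ge_add_one_self[of "d * t"] by linarith
  with d t show "\<bar>t\<bar> \<le> 1 / d * exp (d * t)" by (simp add: field_simps)
qed (rule continuous_on_id)

lemma subexp_add:
  assumes "subexp f" "subexp g"
  shows "subexp (\<lambda>t. f t + g t)"
  unfolding subexp_def
proof (intro conjI allI impI)
  fix d :: real
  assume d: "0 < d"
  from assms(1) d obtain A where A: "\<And>t. 0 \<le> t \<Longrightarrow> \<bar>f t\<bar> \<le> A * exp (d * t)"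
    using subexpE by blast
  from assms(2) d obtain B where B: "\<And>t. 0 \<le> t \<Longrightarrow> \<bar>g t\<bar> \<le> B * exp (d * t)"
    using subexpE by blast
  have "\<bar>f t + g t\<bar> \<le> (A + B) * exp (d * t)" if "0 \<le> t" for t
    using A[OF that] B[OF that] by (simp add: distrib_right)
  then show "\<exists>C. \<forall>t\<ge>0. \<bar>f t + g t\<bar> \<le> C * exp (d * t)" by blast
qed (intro continuous_intros subexp_continuous assms)

lemma subexp_mult:
  assumes "subexp f" "subexp g"
  shows "subexp (\<lambda>t. f t * g t)"
  unfolding subexp_def
proof (intro conjI allI impI)
  fix d :: real
  assume "0 < d"
  then have d: "0 < d / 2" by simp
  from assms(1) d obtain A where A: "0 \<le> A" "\<And>t. 0 \<le> t \<Longrightarrow> \<bar>f t\<bar> \<le> A * exp (d / 2 * t)"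
    using subexpE by blast
  from assms(2) d obtain B where B: "0 \<le> B" "\<And>t. 0 \<le> t \<Longrightarrow> \<bar>g t\<bar> \<le> B * exp (d / 2 * t)"
    using subexpE by blast
  have "\<bar>f t * g t\<bar> \<le> A * B * exp (d * t)" if "0 \<le> t" for t
  proof -
    have "\<bar>f t * g t\<bar> \<le> (A * exp (d / 2 * t)) * (B * exp (d / 2 * t))"
      unfolding abs_mult using A B that by (intro mult_mono) auto
    also have "\<dots> = A * B * (exp (d / 2 * t) * exp (d / 2 * t))" by (simp only: mult.assoc mult.left_commute[of B])
    also have "exp (d / 2 * t) * exp (d / 2 * t) = exp (d * t)" by (simp flip: exp_add)
    finally show ?thesis .
  qed
  then show "\<exists>C. \<forall>t\<ge>0. \<bar>f t * g t\<bar> \<le> C * exp (d * t)" by blast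
qed (intro continuous_intros subexp_continuous assms)

lemma subexp_cmult: "subexp f \<Longrightarrow> subexp (\<lambda>t. c * f t)"
  by (intro subexp_mult subexp_const)

lemma subexp_diff:
  assumes "subexp f" "subexp g"
  shows "subexp (\<lambda>t. f t - g t)"
  using subexp_add[OF assms(1) subexp_cmult[OF assms(2), of "-1"]] by simp

lemma subexp_power: "subexp (\<lambda>t. t ^ n)"
  by (induction n) (auto intro: subexp_const subexp_mult subexp_id)

lemma subexp_exp: "0 \<le> a \<Longrightarrow> subexp (\<lambda>t. exp (- a * t))"
  by (rule subexp_bounded[where C = 1]) (auto intro!: continuous_intros)

lemma subexp_abs: "subexp f \<Longrightarrow> subexp (\<lambda>t. \<bar>f t\<bar>)"
  by (auto simp: subexp_def intro: continuous_intros)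

lemmas subexp_intros =
  subexp_const subexp_id subexp_add subexp_mult subexp_diff subexp_power subexp_abs

definition laplace :: "(real \<Rightarrow> real) \<Rightarrow> real \<Rightarrow> real" where
  "laplace h x = integral {0..} (\<lambda>t. exp (- x * t) * h t)"

text \<open>Half of the decay rate \<open>x\<close> pays for the growth of \<open>h\<close>; the
  other half leaves an integrable majorant.\<close>

lemma laplace_absolutely_integrable:
  assumes "subexp h" "0 < x"
  shows "(\<lambda>t. exp (- x * t) * h t) absolutely_integrable_on {0..}"
proof -
  obtain C where C: "\<And>t. 0 \<le> t \<Longrightarrow> \<bar>h t\<bar> \<le> C * exp (x / 2 * t)"
    using subexpE[OF assms(1), of "x / 2"] assms(2) by auto
  show ?thesis
  proof (rule measurable_bounded_by_integrable_imp_absolutely_integrable)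
    show "(\<lambda>t. exp (- x * t) * h t) \<in> borel_measurable (lebesgue_on {0..})"
      by (intro continuous_imp_measurable_on_sets_lebesgue continuous_intros
            subexp_continuous assms) auto
    show "(\<lambda>t. C * exp (- (x / 2) * t)) integrable_on {0..}"
      using has_integral_mult_right[OF has_integral_exp_minus_to_infinity[of "x / 2" 0], of C] assms(2)
      by (auto simp: integrable_on_def)
    fix t :: real
    assume "t \<in> {0..}"
    then have "exp (- x * t) * \<bar>h t\<bar> \<le> exp (- x * t) * (C * exp (x / 2 * t))"
      using C by (intro mult_left_mono) auto
    also have "\<dots> = C * exp (- (x / 2) * t)"
      by (simp add: mult.left_commute[of _ C] flip: exp_add)
    finally show "norm (exp (- x * t) * h t) \<le> C * exp (- (x / 2) * t)"
      by (simp add: abs_mult)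
  qed auto
qed

lemma laplace_has_integral:
  assumes "subexp h" "0 < x"
  shows "((\<lambda>t. exp (- x * t) * h t) has_integral laplace h x) {0..}"
  unfolding laplace_def
  using laplace_absolutely_integrable[OF assms] set_lebesgue_integral_eq_integral(1)
  by (blast intro: integrable_integral)

lemma laplaceI:
  assumes "((\<lambda>t. exp (- x * t) * h t) has_integral I) {0..}"
  shows "laplace h x = I"
  using assms by (simp add: laplace_def integral_unique)

lemma laplace_add:
  assumes "subexp f" "subexp g" "0 < x"
  shows "laplace (\<lambda>t. f t + g t) x = laplace f x + laplace g x"
  using has_integral_add[OF laplace_has_integral[OF assms(1,3)] laplace_has_integral[OF assms(2,3)]]
  by (intro laplaceI) (simp add: distrib_left)

lemma laplace_diff:
  assumes "subexp f" "subexp g" "0 < x"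
  shows "laplace (\<lambda>t. f t - g t) x = laplace f x - laplace g x"
  using has_integral_diff[OF laplace_has_integral[OF assms(1,3)] laplace_has_integral[OF assms(2,3)]]
  by (intro laplaceI) (simp add: right_diff_distrib)

lemma laplace_cmult:
  assumes "subexp f" "0 < x"
  shows "laplace (\<lambda>t. c * f t) x = c * laplace f x"
  using has_integral_mult_right[OF laplace_has_integral[OF assms], of c]
  by (intro laplaceI) (simp add: mult_ac)

lemma laplace_exp_shift: "laplace (\<lambda>t. exp (- t) * f t) x = laplace f (x + 1)"
proof -
  have "exp (- (x + 1) * t) = exp (- x * t) * exp (- t)" for t :: real
    unfolding exp_add[symmetric] by (simp add: algebra_simps)
  then show ?thesis by (simp only: laplace_def mult.assoc)
qed

lemma laplace_nonneg:
  assumes "subexp h" "0 < x" "\<And>t. 0 \<le> t \<Longrightarrow> 0 \<le> h t"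
  shows "0 \<le> laplace h x"
  by (rule has_integral_nonneg[OF laplace_has_integral[OF assms(1,2)]]) (simp add: assms(3))

text \<open>From |h(t)| \<le> C e^t the transform is at most C/(x - 1) for x > 1.\<close>

lemma laplace_tendsto_0:
  assumes "subexp h"
  shows "(laplace h \<longlongrightarrow> 0) at_top"
proof -
  obtain C where C: "\<And>t. 0 \<le> t \<Longrightarrow> \<bar>h t\<bar> \<le> C * exp (1 * t)"
    using subexpE[OF assms, of 1] by auto
  have bound: "norm (laplace h x) \<le> C / (x - 1)" if "1 < x" for x
  proof -
    have "((\<lambda>t. exp (- (x - 1) * t)) has_integral 1 / (x - 1)) {0..}"
      using has_integral_exp_minus_to_infinity[of "x - 1" 0] that by simp
    from has_integral_mult_right[OF this, of C]
    have int: "((\<lambda>t. C * exp (- (x - 1) * t)) has_integral C / (x - 1)) {0..}" by simp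
    have "norm (integral {0..} (\<lambda>t. exp (- x * t) * h t)) \<le> integral {0..} (\<lambda>t. C * exp (- (x - 1) * t))"
    proof (rule integral_norm_bound_integral)
      show "(\<lambda>t. exp (- x * t) * h t) integrable_on {0..}"
        using laplace_has_integral[OF assms, of x] that by (auto simp: integrable_on_def)
      show "(\<lambda>t. C * exp (- (x - 1) * t)) integrable_on {0..}"
        using int by (auto simp: integrable_on_def)
      fix t :: real
      assume "t \<in> {0..}"
      then have "exp (- x * t) * \<bar>h t\<bar> \<le> exp (- x * t) * (C * exp (1 * t))"
        using C[of t] by (intro mult_left_mono) auto
      also have "\<dots> = C * exp (- (x - 1) * t)"
        by (simp add: mult.left_commute[of _ C] left_diff_distrib flip: exp_add)
      finally show "norm (exp (- x * t) * h t) \<le> C * exp (- (x - 1) * t)"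
        by (simp add: abs_mult)
    qed
    then show ?thesis
      unfolding laplace_def integral_unique[OF int] .
  qed
  show ?thesis
  proof (rule Lim_null_comparison)
    show "\<forall>\<^sub>F x in at_top. norm (laplace h x) \<le> C / (x - 1)"
      using eventually_gt_at_top[of "1::real"] by eventually_elim (rule bound)
    show "((\<lambda>x. C / (x - 1)) \<longlongrightarrow> 0) at_top"
      by real_asymp
  qed
qed

section \<open>Differentiation and integration by parts for Laplace transforms\<close>

lemma exp_linear_approx:
  fixes u :: real
  shows "\<bar>exp u - 1 - u\<bar> \<le> u\<^sup>2 * exp \<bar>u\<bar>"
proof -
  obtain s where s: "\<bar>s\<bar> \<le> \<bar>u\<bar>" "exp u = (\<Sum>m<2. u ^ m / fact m) + exp s / fact 2 * u ^ 2"
    using Maclaurin_exp_le[of u 2] by blast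
  then have "exp u - 1 - u = exp s / 2 * u\<^sup>2"
    by (simp add: numeral_2_eq_2)
  moreover have "exp s / 2 * u\<^sup>2 \<le> exp \<bar>u\<bar> * u\<^sup>2"
  proof (rule mult_right_mono)
    have "exp s \<le> exp \<bar>u\<bar>" using s(1) by simp
    then show "exp s / 2 \<le> exp \<bar>u\<bar>" using exp_gt_zero[of s] by linarith
  qed simp
  moreover have "0 \<le> exp s / 2 * u\<^sup>2" by simp
  ultimately show ?thesis
    by (simp only: abs_of_nonneg mult.commute[of "u\<^sup>2"])
qed

text \<open>With e^(-xt) factored out, this is the quadratic remainder of the exponential at u = -(y
  - x)t. As |u| \<le> xt/2, half of the decay survives.\<close>

lemma exp_difference_quotient:
  fixes x y t :: real
  assumes "\<bar>y - x\<bar> \<le> x / 2" "0 \<le> t"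
  shows "\<bar>exp (- y * t) - exp (- x * t) + (y - x) * (exp (- x * t) * t)\<bar>
    \<le> (y - x)\<^sup>2 * (exp (- (x / 2) * t) * t\<^sup>2)"
proof -
  define u where "u = - ((y - x) * t)"
  have e: "exp (- y * t) = exp (- x * t) * exp u"
    unfolding exp_add[symmetric] by (simp add: u_def algebra_simps)
  have "exp (- y * t) - exp (- x * t) + (y - x) * (exp (- x * t) * t) = exp (- x * t) * (exp u - 1 - u)"
    unfolding e by (simp add: u_def algebra_simps)
  then have "\<bar>exp (- y * t) - exp (- x * t) + (y - x) * (exp (- x * t) * t)\<bar>
      = exp (- x * t) * \<bar>exp u - 1 - u\<bar>"
    by (simp only: abs_mult abs_exp_cancel)
  also have "\<dots> \<le> exp (- x * t) * (u\<^sup>2 * exp \<bar>u\<bar>)"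
    by (intro mult_left_mono exp_linear_approx) simp
  also have "\<dots> = u\<^sup>2 * exp (- x * t + \<bar>u\<bar>)"
    unfolding exp_add by (simp only: mult_ac)
  also have "\<dots> \<le> u\<^sup>2 * exp (- (x / 2) * t)"
  proof -
    have "\<bar>u\<bar> \<le> x / 2 * t"
      using mult_right_mono[OF assms] assms(2) by (simp add: u_def abs_mult)
    then show ?thesis by (intro mult_left_mono) auto
  qed
  finally show ?thesis by (simp add: u_def power_mult_distrib mult_ac)
qed

text \<open>Integrating the quadratic error bound shows that the difference quotient misses the
  claimed derivative by at most |y - x| \<open>K\<close>, with \<open>K\<close> independent of
  \<open>y\<close>.\<close>

lemma laplace_deriv:
  assumes h: "subexp h" and x: "0 < x"
  shows "(laplace h has_real_derivative - laplace (\<lambda>t. t * h t) x) (at x)"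
proof -
  define K where "K = laplace (\<lambda>t. t\<^sup>2 * \<bar>h t\<bar>) (x / 2)"
  have th: "subexp (\<lambda>t. t * h t)" and tth: "subexp (\<lambda>t. t\<^sup>2 * \<bar>h t\<bar>)"
    using h by (auto intro!: subexp_intros)
  have bound: "norm ((laplace h y - laplace h x) / (y - x) - - laplace (\<lambda>t. t * h t) x) \<le> \<bar>y - x\<bar> * K"
    if "y \<noteq> x" "\<bar>y - x\<bar> \<le> x / 2" for y
  proof -
    have y: "0 < y" using that x by linarith
    have int: "((\<lambda>t. exp (- y * t) * h t - exp (- x * t) * h t + (y - x) * (exp (- x * t) * (t * h t)))
        has_integral laplace h y - laplace h x + (y - x) * laplace (\<lambda>t. t * h t) x) {0..}"
      by (intro has_integral_add has_integral_diff has_integral_mult_right laplace_has_integral h th x y)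
    have int': "((\<lambda>t. (y - x)\<^sup>2 * (exp (- (x / 2) * t) * (t\<^sup>2 * \<bar>h t\<bar>))) has_integral (y - x)\<^sup>2 * K) {0..}"
      unfolding K_def using x by (intro has_integral_mult_right laplace_has_integral tth) auto
    have "norm (integral {0..} (\<lambda>t. exp (- y * t) * h t - exp (- x * t) * h t + (y - x) * (exp (- x * t) * (t * h t))))
        \<le> integral {0..} (\<lambda>t. (y - x)\<^sup>2 * (exp (- (x / 2) * t) * (t\<^sup>2 * \<bar>h t\<bar>)))"
    proof (rule integral_norm_bound_integral)
      fix t :: real
      assume "t \<in> {0..}"
      then have "\<bar>exp (- y * t) - exp (- x * t) + (y - x) * (exp (- x * t) * t)\<bar> * \<bar>h t\<bar>
          \<le> (y - x)\<^sup>2 * (exp (- (x / 2) * t) * t\<^sup>2) * \<bar>h t\<bar>"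
        using exp_difference_quotient[OF that(2)] by (intro mult_right_mono) auto
      moreover have "exp (- y * t) * h t - exp (- x * t) * h t + (y - x) * (exp (- x * t) * (t * h t))
          = (exp (- y * t) - exp (- x * t) + (y - x) * (exp (- x * t) * t)) * h t"
        by (simp add: algebra_simps)
      ultimately show "norm (exp (- y * t) * h t - exp (- x * t) * h t + (y - x) * (exp (- x * t) * (t * h t)))
          \<le> (y - x)\<^sup>2 * (exp (- (x / 2) * t) * (t\<^sup>2 * \<bar>h t\<bar>))"
        by (simp only: real_norm_def abs_mult mult.assoc)
    qed (use int int' in \<open>auto simp: integrable_on_def\<close>)
    then have "\<bar>laplace h y - laplace h x + (y - x) * laplace (\<lambda>t. t * h t) x\<bar> \<le> (y - x)\<^sup>2 * K"
      unfolding integral_unique[OF int] integral_unique[OF int'] by simp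
    moreover have "(laplace h y - laplace h x) / (y - x) - - laplace (\<lambda>t. t * h t) x
        = (laplace h y - laplace h x + (y - x) * laplace (\<lambda>t. t * h t) x) / (y - x)"
      using that(1) by (simp add: field_simps)
    moreover have "(y - x)\<^sup>2 * K = \<bar>y - x\<bar> * K * \<bar>y - x\<bar>"
      by (subst power2_abs[symmetric]) (simp only: power2_eq_square mult_ac)
    ultimately show ?thesis
      using that(1) by (simp add: divide_le_eq)
  qed
  have "((\<lambda>y. (laplace h y - laplace h x) / (y - x) - - laplace (\<lambda>t. t * h t) x) \<longlongrightarrow> 0) (at x)"
  proof (rule Lim_null_comparison)
    show "\<forall>\<^sub>F y in at x. norm ((laplace h y - laplace h x) / (y - x) - - laplace (\<lambda>t. t * h t) x) \<le> \<bar>y - x\<bar> * K"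
      unfolding eventually_at using x bound by (intro exI[of _ "x / 2"]) (auto simp: dist_real_def)
    have "((\<lambda>y. \<bar>y - x\<bar> * K) \<longlongrightarrow> \<bar>x - x\<bar> * K) (at x)"
      by (intro tendsto_intros)
    then show "((\<lambda>y. \<bar>y - x\<bar> * K) \<longlongrightarrow> 0) (at x)" by simp
  qed
  then show ?thesis
    unfolding has_field_derivative_iff by (rule LIM_zero_cancel)
qed

lemma exp_mult_subexp_tendsto_0:
  assumes "subexp h" "0 < x"
  shows "((\<lambda>t. exp (- x * t) * h t) \<longlongrightarrow> 0) at_top"
proof -
  obtain C where C: "\<And>t. 0 \<le> t \<Longrightarrow> \<bar>h t\<bar> \<le> C * exp (x / 2 * t)"
    using subexpE[OF assms(1), of "x / 2"] assms(2) by auto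
  show ?thesis
  proof (rule Lim_null_comparison)
    show "\<forall>\<^sub>F t in at_top. norm (exp (- x * t) * h t) \<le> C * exp (- (x / 2 * t))"
      using eventually_ge_at_top[of "0::real"]
    proof eventually_elim
      case (elim t)
      have "exp (- x * t) * \<bar>h t\<bar> \<le> exp (- x * t) * (C * exp (x / 2 * t))"
        using C[OF elim] by (intro mult_left_mono) auto
      also have "\<dots> = C * exp (- (x / 2 * t))"
        by (simp add: mult.left_commute[of _ C] flip: exp_add)
      finally show ?case by (simp add: abs_mult)
    qed
    have "((\<lambda>t. C * exp (- (x / 2 * t))) \<longlongrightarrow> C * 0) at_top"
      using assms(2)
      by (intro tendsto_mult tendsto_const filterlim_compose[OF exp_at_bot]
            filterlim_compose[OF filterlim_uminus_at_bot_at_top]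
            filterlim_tendsto_pos_mult_at_top[OF tendsto_const] filterlim_ident) auto
    then show "((\<lambda>t. C * exp (- (x / 2 * t))) \<longlongrightarrow> 0) at_top" by simp
  qed
qed

text \<open>The fundamental theorem is applied to e^(-xt) h(t), whose derivative is
  \<open>u'\<close>, on [0, b]. As b grows, the boundary term at b vanishes by subexponential
  growth.\<close>

lemma laplace_by_parts:
  assumes h: "subexp h" "subexp h'" and x: "0 < x"
    and deriv: "\<And>t. 0 \<le> t \<Longrightarrow> (h has_real_derivative h' t) (at t within {0..})"
  shows "x * laplace h x = h 0 + laplace h' x"
proof -
  define u' where "u' t = exp (- x * t) * (h' t - x * h t)" for t
  have sub: "subexp (\<lambda>t. h' t - x * h t)"
    using h by (auto intro!: subexp_intros)
  have "integral {0..} u' = laplace (\<lambda>t. h' t - x * h t) x"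
    by (simp add: laplace_def u'_def [abs_def])
  also have "\<dots> = laplace h' x - x * laplace h x"
    using h x by (simp add: laplace_diff laplace_cmult subexp_cmult)
  finally have total: "integral {0..} u' = laplace h' x - x * laplace h x" .
  have ai: "u' absolutely_integrable_on {0..}"
    unfolding u'_def [abs_def] by (rule laplace_absolutely_integrable[OF sub x])
  have partial: "set_lebesgue_integral lebesgue {0..b} u' = exp (- x * b) * h b - h 0" if "0 \<le> b" for b
  proof -
    have "(u' has_integral (exp (- x * b) * h b - exp (- x * 0) * h 0)) {0..b}"
    proof (rule fundamental_theorem_of_calculus[OF that])
      fix t
      assume t: "t \<in> {0..b}"
      have h't: "(h has_real_derivative h' t) (at t within {0..b})"
        by (rule DERIV_subset[OF deriv]) (use t in auto)
      have "((\<lambda>t. exp (- x * t) * h t) has_real_derivative u' t) (at t within {0..b})"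
        unfolding u'_def by (rule derivative_eq_intros h't refl)+ (simp add: algebra_simps)
      then show "((\<lambda>t. exp (- x * t) * h t) has_vector_derivative u' t) (at t within {0..b})"
        by (simp add: has_real_derivative_iff_has_vector_derivative)
    qed
    moreover have "set_integrable lebesgue {0..b} u'"
      by (rule set_integrable_subset[OF ai]) auto
    ultimately show ?thesis
      by (simp add: set_lebesgue_integral_eq_integral(2) integral_unique)
  qed
  have "((\<lambda>b. set_lebesgue_integral lebesgue {0..b} u') \<longlongrightarrow> set_lebesgue_integral lebesgue {0..} u') at_top"
    by (rule tendsto_set_lebesgue_integral_at_top[OF _ ai]) auto
  moreover have "((\<lambda>b. set_lebesgue_integral lebesgue {0..b} u') \<longlongrightarrow> 0 - h 0) at_top"
  proof (rule Lim_transform_eventually)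
    show "((\<lambda>b. exp (- x * b) * h b - h 0) \<longlongrightarrow> 0 - h 0) at_top"
      by (intro tendsto_diff exp_mult_subexp_tendsto_0 tendsto_const h x)
    show "\<forall>\<^sub>F b in at_top. exp (- x * b) * h b - h 0 = set_lebesgue_integral lebesgue {0..b} u'"
      using eventually_ge_at_top[of "0::real"] by eventually_elim (simp add: partial)
  qed
  ultimately have "set_lebesgue_integral lebesgue {0..} u' = 0 - h 0"
    by (rule tendsto_unique[rotated]) simp
  then show ?thesis
    using total ai by (simp add: set_lebesgue_integral_eq_integral(2))
qed

lemma laplace_power:
  assumes "0 < x"
  shows "laplace (\<lambda>t. t ^ m) x = fact m / x ^ Suc m"
proof (induction m)
  case 0
  have "x * laplace (\<lambda>_. 1) x = 1 + laplace (\<lambda>_. 0) x"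
    by (rule laplace_by_parts) (auto intro!: subexp_intros derivative_eq_intros assms)
  also have "laplace (\<lambda>_. 0) x = 0" by (simp add: laplace_def)
  finally show ?case using assms by (simp add: field_simps)
next
  case (Suc m)
  have "x * laplace (\<lambda>t. t ^ Suc m) x = 0 ^ Suc m + laplace (\<lambda>t. real (Suc m) * t ^ m) x"
    by (rule laplace_by_parts)
       (auto intro!: subexp_intros derivative_eq_intros assms simp del: power_Suc of_nat_Suc)
  also have "laplace (\<lambda>t. real (Suc m) * t ^ m) x = real (Suc m) * laplace (\<lambda>t. t ^ m) x"
    by (rule laplace_cmult) (auto intro: subexp_intros assms)
  finally show ?case using assms by (simp add: Suc.IH field_simps)
qed

section \<open>Iterated derivatives and complete monotonicity\<close>

text \<open>A chain of successive derivatives on \<open>S\<close> identifies all iterated ones. The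
  first premise makes derivatives relative to \<open>S\<close> unique, and agreement on
  \<open>S\<close> alone suffices because every derivative is taken within \<open>S\<close>.\<close>

lemma nth_deriv_on_eqI:
  assumes "\<And>x. x \<in> S \<Longrightarrow> at x within S \<noteq> bot"
    and "\<And>x. x \<in> S \<Longrightarrow> f x = G 0 x"
    and "\<And>j x. j < m \<Longrightarrow> x \<in> S \<Longrightarrow> (G j has_real_derivative G (Suc j) x) (at x within S)"
  shows "j \<le> m \<Longrightarrow> x \<in> S \<Longrightarrow> nth_deriv_on S j f x = G j x"
    and "times_differentiable_on m f S"
proof -
  have deriv: "(nth_deriv_on S j f has_vector_derivative G (Suc j) x) (at x within S)"
    if "j < m" "x \<in> S" "\<And>x. x \<in> S \<Longrightarrow> nth_deriv_on S j f x = G j x" for j x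
    using assms(3)[OF that(1,2)]
    by (intro has_vector_derivative_transform[OF that(2,3)])
       (auto simp: has_real_derivative_iff_has_vector_derivative)
  have eq: "j \<le> m \<Longrightarrow> x \<in> S \<Longrightarrow> nth_deriv_on S j f x = G j x" for j x
  proof (induction j arbitrary: x)
    case (Suc j)
    then show ?case
      using vector_derivative_within[OF assms(1) deriv[of j x]] by simp
  qed (simp add: assms(2))
  then show "j \<le> m \<Longrightarrow> x \<in> S \<Longrightarrow> nth_deriv_on S j f x = G j x" .
  show "times_differentiable_on m f S"
    unfolding times_differentiable_on_def differentiable_on_def
    using deriv eq by (metis less_imp_le differentiableI_vector)
qed

text \<open>The easy direction of Bernstein's theorem: each differentiation brings down a factor -t,
  and the signs cancel against (-1)^m.\<close>

lemma completely_monotonic_laplace: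
  assumes "subexp h" "\<And>t. 0 \<le> t \<Longrightarrow> 0 \<le> h t" "\<And>x. 0 < x \<Longrightarrow> g x = laplace h x"
  shows "completely_monotonic g"
proof -
  define G where "G m x = (- 1) ^ m * laplace (\<lambda>t. t ^ m * h t) x" for m x
  have sub: "subexp (\<lambda>t. t ^ m * h t)" for m
    using assms(1) by (intro subexp_intros)
  have nontriv: "at x within {0<..} \<noteq> bot" if "x \<in> {0<..}" for x :: real
    using that by (subst at_within_open) auto
  have G0: "g x = G 0 x" if "x \<in> {0<..}" for x
    using that assms(3) by (simp add: G_def)
  have Gderiv: "(G j has_real_derivative G (Suc j) x) (at x within {0<..})" if "x \<in> {0<..}" for j x
  proof -
    have "(G j has_real_derivative (- 1) ^ j * - laplace (\<lambda>t. t * (t ^ j * h t)) x) (at x)"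
      unfolding G_def [abs_def] using that by (intro DERIV_cmult laplace_deriv sub) simp
    moreover have "(- 1) ^ j * - laplace (\<lambda>t. t * (t ^ j * h t)) x = G (Suc j) x"
      unfolding G_def power_Suc mult.assoc by simp
    ultimately have "(G j has_real_derivative G (Suc j) x) (at x)" by (simp only:)
    then show ?thesis by (rule has_field_derivative_at_within)
  qed
  note * = nth_deriv_on_eqI[where G = G, OF nontriv G0 Gderiv]
  have "0 \<le> (- 1) ^ m * nth_deriv_on {0<..} m g x" if "0 < x" for m x
  proof -
    have "0 \<le> laplace (\<lambda>t. t ^ m * h t) x"
      using assms(2) that by (intro laplace_nonneg sub) auto
    then show ?thesis
      using that *(1)[of m m x] by (simp add: G_def)
  qed
  with *(2) show ?thesis by (auto simp: completely_monotonic_def)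
qed

section \<open>Binet's formula\<close>

lemma continuous_on_V_series: "continuous_on A (V_series n)"
  unfolding V_series_def by (rule continuous_on_lorentz_series) simp

lemma subexp_V_series: "subexp (V_series n)"
  by (rule subexp_bounded[OF continuous_on_V_series, of _ "V_series 0 0"])
     (use V_series_bounds in auto)

text \<open>The error in Stirling's formula, equal to R_0 for x > 0; \<open>ln_Gamma\<close> gives
  access to the polygamma functions as derivatives.\<close>

definition stirling_diff :: "real \<Rightarrow> real" where
  "stirling_diff x = ln_Gamma x - ((x - 1 / 2) * ln x - x + 1 / 2 * ln (2 * pi))"

lemma stirling_diff_deriv:
  assumes "0 < x"
  shows "(stirling_diff has_real_derivative Digamma x - ln x + 1 / (2 * x)) (at x)"
  unfolding stirling_diff_def [abs_def]
  by (rule derivative_eq_intros has_field_derivative_ln_Gamma_real assms refl)+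
     (use assms in \<open>auto simp: field_simps\<close>)

lemma stirling_diff_deriv2:
  assumes "0 < x"
  shows "((\<lambda>x. Digamma x - ln x + 1 / (2 * x)) has_real_derivative
    Polygamma 1 x - 1 / x - 1 / (2 * x\<^sup>2)) (at x)"
proof -
  have "x \<notin> \<int>\<^sub>\<le>\<^sub>0" using assms by (auto elim!: nonpos_Ints_cases)
  then show ?thesis
    using assms by (auto intro!: derivative_eq_intros simp: field_simps power2_eq_square)
qed

text \<open>For t \<noteq> 0 this is t/(e^t - 1) - 1 + t/2. The nesting of the products is what two
  uses of \<open>laplace_deriv\<close> on \<open>V_series 0\<close> produce.\<close>

definition exp_quotient_tail :: "real \<Rightarrow> real" where
  "exp_quotient_tail t = t * (t * V_series 0 t)"

lemma subexp_exp_quotient_tail: "subexp exp_quotient_tail"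
  unfolding exp_quotient_tail_def [abs_def] by (intro subexp_intros subexp_V_series)

text \<open>The quotient identity multiplied by e^(-t), arranged so that the right-hand side
  consists of powers of t, with or without a factor e^(-t).\<close>

lemma exp_quotient_tail_identity:
  "exp_quotient_tail t - exp (- t) * exp_quotient_tail t
    = 1 / 2 * (exp (- t) * t) + exp (- t) * t ^ 0 - t ^ 0 + 1 / 2 * t"
proof -
  have "(1 - t / 2 + exp_quotient_tail t) * ((exp t - 1) * exp (- t)) = t * exp (- t)"
    using exp_quotient_eq_V_series[of t]
    by (simp add: exp_quotient_tail_def power2_eq_square mult.assoc[symmetric])
  also have "(exp t - 1) * exp (- t) = 1 - exp (- t)"
    by (simp add: left_diff_distrib flip: exp_add)
  finally show ?thesis by (simp add: field_simps)
qed

text \<open>A factor e^(-t) shifts the transform by 1, which turns the preceding identity into a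
  difference equation; the trigamma expression satisfies the same one.\<close>

lemma laplace_exp_quotient_tail_step:
  assumes "0 < x"
  shows "laplace exp_quotient_tail x - laplace exp_quotient_tail (x + 1)
    = 1 / (2 * (x + 1)\<^sup>2) + 1 / (x + 1) - 1 / x + 1 / (2 * x\<^sup>2)"
proof -
  have e: "subexp (\<lambda>t. exp (- t))" using subexp_exp[of 1] by simp
  have "laplace exp_quotient_tail x - laplace exp_quotient_tail (x + 1)
      = laplace (\<lambda>t. exp_quotient_tail t - exp (- t) * exp_quotient_tail t) x"
    using assms by (simp add: laplace_diff laplace_exp_shift subexp_exp_quotient_tail subexp_mult e)
  also have "\<dots> = laplace (\<lambda>t. 1 / 2 * (exp (- t) * t ^ 1) + exp (- t) * t ^ 0 - t ^ 0 + 1 / 2 * t ^ 1) x"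
    unfolding exp_quotient_tail_identity by simp
  also have "\<dots> = 1 / 2 * laplace (\<lambda>t. t ^ 1) (x + 1) + laplace (\<lambda>t. t ^ 0) (x + 1)
      - laplace (\<lambda>t. t ^ 0) x + 1 / 2 * laplace (\<lambda>t. t ^ 1) x"
    using assms e
    by (simp only: laplace_add laplace_diff laplace_cmult laplace_exp_shift
          subexp_intros subexp_power)
  also have "\<dots> = 1 / (2 * (x + 1)\<^sup>2) + 1 / (x + 1) - 1 / x + 1 / (2 * x\<^sup>2)"
    unfolding laplace_power[OF assms] laplace_power[OF add_pos_pos[OF assms zero_less_one]]
    by (simp add: power2_eq_square)
  finally show ?thesis .
qed

text \<open>The values are the tails of the convergent series of 1/(x + k)^2.\<close>

lemma trigamma_tendsto_0:
  fixes x :: real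
  assumes "0 < x"
  shows "(\<lambda>N. Polygamma 1 (x + real N)) \<longlonglongrightarrow> 0"
proof -
  have "(\<lambda>k. inverse ((x + of_nat k) ^ Suc 1)) sums Polygamma 1 x"
    using Polygamma_LIMSEQ[of x 1] assms by simp
  then have "(\<lambda>N. Polygamma 1 x - (\<Sum>k<N. inverse ((x + of_nat k) ^ Suc 1))) \<longlonglongrightarrow> Polygamma 1 x - Polygamma 1 x"
    unfolding sums_def by (intro tendsto_intros)
  moreover have "Polygamma 1 (x + real N) = Polygamma 1 x - (\<Sum>k<N. inverse ((x + of_nat k) ^ Suc 1))" for N
    using assms by (subst Polygamma_plus_of_nat) (auto simp: inverse_eq_divide)
  ultimately show ?thesis by simp
qed

text \<open>Both sides satisfy the same first-order difference equation and tend to \<open>0\<close>.\<close>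

lemma trigamma_laplace:
  assumes "0 < x"
  shows "Polygamma 1 x - 1 / x - 1 / (2 * x\<^sup>2) = laplace exp_quotient_tail x"
proof -
  define E where "E x = Polygamma 1 x - 1 / x - 1 / (2 * x\<^sup>2) - laplace exp_quotient_tail x" for x :: real
  have step: "E (y + 1) = E y" if "0 < y" for y
    using laplace_exp_quotient_tail_step[OF that] Polygamma_plus1[of y 1] that
    by (simp add: E_def power2_eq_square)
  have "E (x + real N) = E x" for N
  proof (induction N)
    case (Suc N)
    have eq: "x + real (Suc N) = x + real N + 1" by simp
    show ?case
      unfolding eq using step[of "x + real N"] assms Suc.IH by (simp only: add_pos_nonneg of_nat_0_le_iff)
  qed simp
  moreover have "(\<lambda>N. E (x + real N)) \<longlonglongrightarrow> 0 - 0 - 0 - 0"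
    unfolding E_def
  proof (intro tendsto_diff trigamma_tendsto_0 assms)
    show "(\<lambda>N. 1 / (x + real N)) \<longlonglongrightarrow> 0" by real_asymp
    show "(\<lambda>N. 1 / (2 * (x + real N)\<^sup>2)) \<longlonglongrightarrow> 0" by real_asymp
    have "filterlim (\<lambda>N. x + real N) at_top sequentially" by real_asymp
    then show "(\<lambda>N. laplace exp_quotient_tail (x + real N)) \<longlonglongrightarrow> 0"
      by (rule filterlim_compose[OF laplace_tendsto_0[OF subexp_exp_quotient_tail]])
  qed
  ultimately have "E x = 0" by (simp add: LIMSEQ_const_iff)
  then show ?thesis by (simp add: E_def)
qed

section \<open>Conditions that fix the affine difference in Binet's formula\<close>

text \<open>The equation \<Gamma>(x + 1) = x \<Gamma>(x) makes the difference elementary.\<close>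

lemma stirling_diff_step_tendsto_0: "((\<lambda>x. stirling_diff (x + 1) - stirling_diff x) \<longlongrightarrow> 0) at_top"
proof (rule Lim_transform_eventually)
  show "((\<lambda>x::real. (x + 1 / 2) * ln x - (x + 1 / 2) * ln (x + 1) + 1) \<longlongrightarrow> 0) at_top"
    by real_asymp
  show "\<forall>\<^sub>F x in at_top. (x + 1 / 2) * ln x - (x + 1 / 2) * ln (x + 1) + 1 = stirling_diff (x + 1) - stirling_diff x"
    using eventually_gt_at_top[of "0::real"]
  proof eventually_elim
    case (elim x)
    then have "x \<notin> \<int>\<^sub>\<le>\<^sub>0" by (auto elim!: nonpos_Ints_cases)
    then have "ln_Gamma (x + 1) = ln x + ln_Gamma x"
      using elim Gamma_real_pos[OF elim]
      by (simp add: ln_Gamma_real_pos Gamma_plus1 ln_mult del: Gamma_real_pos)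
    then show ?case by (simp add: stirling_diff_def algebra_simps)
  qed
qed

text \<open>The logarithm of Legendre's duplication formula, restricted from complex arguments to
  the positive axis.\<close>

lemma ln_Gamma_duplication:
  fixes x :: real
  assumes "0 < x"
  shows "ln_Gamma x + ln_Gamma (x + 1 / 2) = (1 - 2 * x) * ln 2 + 1 / 2 * ln pi + ln_Gamma (2 * x)"
proof -
  have ni: "complex_of_real y \<notin> \<int>\<^sub>\<le>\<^sub>0" if "0 < y" for y
    using that by (metis of_real_in_nonpos_Ints_iff nonpos_Ints_nonpos not_le)
  have "complex_of_real (Gamma x * Gamma (x + 1 / 2))
      = Gamma (complex_of_real x) * Gamma (complex_of_real x + 1 / 2)"
    by (simp add: Gamma_complex_of_real [symmetric])
  also have "\<dots> = exp ((1 - 2 * complex_of_real x) * of_real (ln 2)) * of_real (sqrt pi) * Gamma (2 * complex_of_real x)"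
    using ni[of x] ni[of "x + 1 / 2"] assms by (intro Gamma_legendre_duplication) simp_all
  also have "\<dots> = complex_of_real (exp ((1 - 2 * x) * ln 2) * sqrt pi * Gamma (2 * x))"
    by (simp add: Gamma_complex_of_real [symmetric] exp_of_real [symmetric])
  finally have "Gamma x * Gamma (x + 1 / 2) = exp ((1 - 2 * x) * ln 2) * sqrt pi * Gamma (2 * x)"
    by (simp only: of_real_eq_iff)
  then have "ln (Gamma x * Gamma (x + 1 / 2)) = ln (exp ((1 - 2 * x) * ln 2) * sqrt pi * Gamma (2 * x))"
    by simp
  moreover have "0 < Gamma x" "0 < Gamma (x + 1 / 2)" "0 < Gamma (2 * x)"
    using assms by (auto intro!: Gamma_real_pos)
  ultimately show ?thesis
    using assms by (simp add: ln_Gamma_real_pos ln_mult ln_sqrt)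
qed

text \<open>A constant d contributes d + d - d = d to this combination, so its limit detects an
  additive constant, while duplication removes all Gamma terms.\<close>

lemma stirling_diff_duplication_tendsto_0:
  "((\<lambda>x. stirling_diff x + stirling_diff (x + 1 / 2) - stirling_diff (2 * x)) \<longlongrightarrow> 0) at_top"
proof (rule Lim_transform_eventually)
  show "((\<lambda>x::real. x * ln x - x * ln (x + 1 / 2) + 1 / 2) \<longlongrightarrow> 0) at_top"
    by real_asymp
  show "\<forall>\<^sub>F x in at_top. x * ln x - x * ln (x + 1 / 2) + 1 / 2
      = stirling_diff x + stirling_diff (x + 1 / 2) - stirling_diff (2 * x)"
    using eventually_gt_at_top[of "0::real"]
  proof eventually_elim
    case (elim x)
    have *: "ln (2 * x) = ln 2 + ln x" "ln (2 * pi) = ln 2 + ln pi"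
      using elim by (simp_all add: ln_mult)
    have "stirling_diff x + stirling_diff (x + 1 / 2) - stirling_diff (2 * x)
        = (ln_Gamma x + ln_Gamma (x + 1 / 2)) - ln_Gamma (2 * x)
          - ((x - 1 / 2) * ln x + x * ln (x + 1 / 2) - (2 * x - 1 / 2) * ln (2 * x) - 1 / 2 + 1 / 2 * ln (2 * pi))"
      by (simp add: stirling_diff_def algebra_simps)
    also have "\<dots> = x * ln x - x * ln (x + 1 / 2) + 1 / 2"
      unfolding ln_Gamma_duplication[OF elim] * by (simp add: field_simps)
    finally show ?case by simp
  qed
qed

text \<open>The second derivatives agree, so the difference is affine. Its slope vanishes by the
  functional equation of \<open>\<Gamma>\<close>, and its constant term by the duplication formula.\<close>

theorem Binet_formula:
  assumes "0 < x"
  shows "stirling_diff x = laplace (V_series 0) x"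
proof -
  define D where "D y = stirling_diff y - laplace (V_series 0) y" for y
  define D' where "D' y = Digamma y - ln y + 1 / (2 * y) + laplace (\<lambda>t. t * V_series 0 t) y" for y :: real
  note lim0 = laplace_tendsto_0[OF subexp_V_series[of 0]]
  have tV: "subexp (\<lambda>t. t * V_series 0 t)" by (intro subexp_intros subexp_V_series)
  have D_deriv: "(D has_real_derivative D' y) (at y)" if "0 < y" for y
    unfolding D_def [abs_def] D'_def
    using DERIV_diff[OF stirling_diff_deriv[OF that] laplace_deriv[OF subexp_V_series[of 0] that]]
    by simp
  have D'_deriv: "(D' has_real_derivative 0) (at y)" if "0 < y" for y
    unfolding D'_def [abs_def]
    using DERIV_add[OF stirling_diff_deriv2[OF that] laplace_deriv[OF tV that]]
      trigamma_laplace[OF that]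
    by (simp add: exp_quotient_tail_def [abs_def])
  have "\<exists>c. \<forall>y\<in>{0<..}. D' y = c"
    by (rule has_field_derivative_zero_constant) (auto intro: has_field_derivative_at_within D'_deriv)
  then obtain c where c: "\<And>y. 0 < y \<Longrightarrow> D' y = c" by auto
  have "\<exists>d. \<forall>y\<in>{0<..}. D y - c * y = d"
  proof (rule has_field_derivative_zero_constant)
    fix y :: real
    assume "y \<in> {0<..}"
    then have "((\<lambda>y. D y - c * y) has_real_derivative c - c * 1) (at y)"
      using D_deriv[of y] c[of y] by (intro DERIV_diff DERIV_cmult DERIV_ident) auto
    then show "((\<lambda>y. D y - c * y) has_real_derivative 0) (at y within {0<..})"
      by (auto intro: has_field_derivative_at_within)
  qed auto
  then obtain d where "\<And>y. 0 < y \<Longrightarrow> D y - c * y = d" by auto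
  then have d: "D y = c * y + d" if "0 < y" for y
    using that by (metis diff_add_cancel add.commute)
  have comp: "((\<lambda>y. laplace (V_series 0) (f y)) \<longlongrightarrow> 0) at_top" if "filterlim f at_top at_top" for f :: "real \<Rightarrow> real"
    using filterlim_compose[OF lim0 that] .
  have "((\<lambda>y. (stirling_diff (y + 1) - stirling_diff y)
      - (laplace (V_series 0) (y + 1) - laplace (V_series 0) y)) \<longlongrightarrow> 0 - (0 - 0)) at_top"
    by (intro tendsto_diff stirling_diff_step_tendsto_0 comp lim0) real_asymp
  moreover have "\<forall>\<^sub>F y in at_top. (stirling_diff (y + 1) - stirling_diff y)
      - (laplace (V_series 0) (y + 1) - laplace (V_series 0) y) = c"
    using eventually_gt_at_top[of "0::real"]
  proof eventually_elim
    case (elim y)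
    then show ?case
      using d[of y] d[of "y + 1"] unfolding D_def by (simp add: distrib_left)
  qed
  ultimately have "((\<lambda>y::real. c) \<longlongrightarrow> 0) at_top"
    by (simp add: tendsto_cong)
  then have "c = 0" by (simp add: tendsto_const_iff)
  have "((\<lambda>y. (stirling_diff y + stirling_diff (y + 1 / 2) - stirling_diff (2 * y))
      - (laplace (V_series 0) y + laplace (V_series 0) (y + 1 / 2) - laplace (V_series 0) (2 * y)))
      \<longlongrightarrow> 0 - (0 + 0 - 0)) at_top"
    by (intro tendsto_diff tendsto_add stirling_diff_duplication_tendsto_0 comp lim0) real_asymp+
  moreover have "\<forall>\<^sub>F y in at_top. (stirling_diff y + stirling_diff (y + 1 / 2) - stirling_diff (2 * y))
      - (laplace (V_series 0) y + laplace (V_series 0) (y + 1 / 2) - laplace (V_series 0) (2 * y)) = d"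
    using eventually_gt_at_top[of "0::real"]
  proof eventually_elim
    case (elim y)
    then show ?case
      using d[of y] d[of "y + 1 / 2"] d[of "2 * y"] \<open>c = 0\<close> unfolding D_def by simp
  qed
  ultimately have "((\<lambda>y::real. d) \<longlongrightarrow> 0) at_top"
    by (simp add: tendsto_cong)
  then have "d = 0" by (simp add: tendsto_const_iff)
  with d[OF assms] \<open>c = 0\<close> show ?thesis by (simp add: D_def)
qed

text \<open>Induction through t^(2n+2) V_{n+1}(t) = V_n(0) t^(2n) - t^(2n) V_n(t). The transform of
  the monomial is, up to sign, the next Bernoulli term of the asymptotic expansion.\<close>

theorem logGamma_rem_laplace:
  assumes "0 < x"
  shows "logGamma_rem n x = laplace (\<lambda>t. t ^ (2 * n) * V_series n t) x"
proof (induction n)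
  case 0
  show ?case
    using Binet_formula[OF assms] assms
    by (simp add: logGamma_rem_def stirling_diff_def ln_Gamma_real_pos)
next
  case (Suc n)
  have sub: "subexp (\<lambda>t. t ^ (2 * n) * V_series n t)"
    by (intro subexp_intros subexp_V_series)
  have "t ^ (2 * Suc n) * V_series (Suc n) t = V_series n 0 * t ^ (2 * n) - t ^ (2 * n) * V_series n t" for t
  proof -
    have "t ^ (2 * Suc n) * V_series (Suc n) t = t ^ (2 * n) * (t\<^sup>2 * V_series (Suc n) t)"
      by (simp add: power2_eq_square)
    also have "t\<^sup>2 * V_series (Suc n) t = V_series n 0 - V_series n t"
      using V_series_recursion[of n t] by simp
    finally show ?thesis by (simp add: algebra_simps)
  qed
  then have "laplace (\<lambda>t. t ^ (2 * Suc n) * V_series (Suc n) t) x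
      = V_series n 0 * (fact (2 * n) / x ^ Suc (2 * n)) - logGamma_rem n x"
    using assms sub
    by (simp only: laplace_diff laplace_cmult subexp_cmult subexp_power laplace_power Suc.IH)
  also have "V_series n 0 * (fact (2 * n) / x ^ Suc (2 * n))
      = (- 1) ^ n * (bernoulli (2 * Suc n) / ((2 * real (Suc n) - 1) * (2 * real (Suc n))) * (1 / x ^ (2 * Suc n - 1)))"
  proof -
    have f: "fact (2 * Suc n) = (2 * real (Suc n) - 1) * (2 * real (Suc n)) * fact (2 * n)"
      by (simp add: algebra_simps)
    have p: "(2 * real (Suc n) - 1) * (2 * real (Suc n)) \<noteq> 0" by simp
    have "bernoulli (2 * Suc n) = (- 1) ^ n * V_series n 0 * fact (2 * Suc n)"
      using bernoulli_eq_V_series[of n] by (simp add: divide_eq_eq)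
    then have "bernoulli (2 * Suc n) / ((2 * real (Suc n) - 1) * (2 * real (Suc n)))
        = (- 1) ^ n * V_series n 0 * fact (2 * n)"
      using p unfolding f by simp
    then show ?thesis by simp
  qed
  also have "\<dots> - logGamma_rem n x = logGamma_rem (Suc n) x"
    unfolding logGamma_rem_def by (simp add: algebra_simps)
  finally show ?case by simp
qed

section \<open>Derivatives of \<open>r\<^sub>n\<close>\<close>

text \<open>The closed form of the j-th derivative of r_n, meaningful for j \<le> 2n, where the
  subtraction is not truncated.\<close>

definition r_deriv :: "nat \<Rightarrow> nat \<Rightarrow> real \<Rightarrow> real" where
  "r_deriv n j t = t ^ (2 * n - j) * lorentz_series (2 * n + 2) (euler_chain j (Suc (2 * n - j))) t"

lemma r_fun_eq_r_deriv: "0 \<le> t \<Longrightarrow> r_fun n t = r_deriv n 0 t"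
  by (simp add: r_fun_def r_deriv_def V_fun_eq_V_series V_series_def)

lemma r_deriv_deriv:
  assumes "j < 2 * n"
  shows "(r_deriv n j has_real_derivative r_deriv n (Suc j) t) (at t)"
proof -
  have p: "2 * n - j = Suc (2 * n - Suc j)" using assms by simp
  show ?thesis
    unfolding r_deriv_def [abs_def] euler_chain.simps p
    by (rule power_lorentz_series_deriv) simp
qed

lemma r_deriv_0: "j < 2 * n \<Longrightarrow> r_deriv n j 0 = 0"
  by (simp add: r_deriv_def)

text \<open>The chain has positive coefficients if j < 2n - j + 1, that is j \<le> n. This is where
  the restriction k \<le> n enters.\<close>

lemma lorentz_series_euler_chain_pos:
  assumes "j \<le> n"
  shows "0 < lorentz_series (2 * n + 2) (euler_chain j (Suc (2 * n - j))) t"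
proof -
  have "nonneg_poly (Suc j) (euler_chain j (Suc (2 * n - j)))"
    using assms by (intro nonneg_poly_euler_chain) simp
  then show ?thesis
    by (intro lorentz_series_pos nonneg_poly_pos) simp_all
qed

lemma r_deriv_pos: "j \<le> n \<Longrightarrow> 0 < t \<Longrightarrow> 0 < r_deriv n j t"
  unfolding r_deriv_def by (intro mult_pos_pos lorentz_series_euler_chain_pos) simp_all

lemma r_deriv_nonneg: "j \<le> n \<Longrightarrow> 0 \<le> t \<Longrightarrow> 0 \<le> r_deriv n j t"
  unfolding r_deriv_def
  by (intro mult_nonneg_nonneg less_imp_le[OF lorentz_series_euler_chain_pos]) simp_all

lemma subexp_r_deriv: "subexp (r_deriv n j)"
proof -
  let ?Q = "euler_chain j (Suc (2 * n - j))"
  obtain C where "\<And>t. \<bar>lorentz_series (2 * n + 2) ?Q t\<bar> \<le> C"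
    using lorentz_series_bounded[of "2 * n + 2" ?Q] by auto
  then have "subexp (lorentz_series (2 * n + 2) ?Q)"
    by (intro subexp_bounded continuous_on_lorentz_series) simp_all
  then show ?thesis
    unfolding r_deriv_def [abs_def] by (intro subexp_intros)
qed

text \<open>Each integration by parts supplies a factor \<open>x\<close>; the boundary terms vanish
  because the derivatives of order below n are zero at 0.\<close>

lemma laplace_r_deriv:
  assumes "0 < x" "j \<le> n"
  shows "laplace (r_deriv n j) x = x ^ j * logGamma_rem n x"
  using assms(2)
proof (induction j)
  case 0
  show ?case
    by (simp add: logGamma_rem_laplace[OF assms(1)] r_deriv_def [abs_def] V_series_def)
next
  case (Suc j)
  have "x * laplace (r_deriv n j) x = r_deriv n j 0 + laplace (r_deriv n (Suc j)) x"
    using Suc.prems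
    by (intro laplace_by_parts subexp_r_deriv assms has_field_derivative_at_within[OF r_deriv_deriv]) simp
  with Suc show ?case by (simp add: r_deriv_0 mult.assoc)
qed

theorem theorem2p1:
  fixes k n :: nat
  assumes "n \<ge> k"
  shows "completely_monotonic_of_order (real k) (logGamma_rem n) \<and>
    (\<forall>x>0. ((\<lambda>t. exp (- x * t) * r_fun n t) has_integral logGamma_rem n x) {0..}) \<and>
    times_differentiable_on k (r_fun n) {0..} \<and>
    (\<forall>l<k. nth_deriv_on {0..} l (r_fun n) 0 = 0) \<and>
    (\<forall>t>0. nth_deriv_on {0..} k (r_fun n) t > 0)"
proof -
  \<comment> \<open>Also at the endpoint 0, where derivatives are one-sided, the filter is proper
    because it contains approach from the right.\<close>
  have nontriv: "at t within {0..} \<noteq> bot" if "t \<in> {0..}" for t :: real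
  proof -
    have "at t within {t<..} \<noteq> bot" by simp
    moreover have "at t within {t<..} \<le> at t within {0..}"
      using that by (intro at_le) auto
    ultimately show ?thesis by (metis bot.extremum_uniqueI)
  qed
  have r0: "r_fun n t = r_deriv n 0 t" if "t \<in> {0..}" for t
    using that by (intro r_fun_eq_r_deriv) simp
  have rd: "(r_deriv n j has_real_derivative r_deriv n (Suc j) t) (at t within {0..})"
    if "j < k" "t \<in> {0..}" for j t
    using that assms by (intro has_field_derivative_at_within[OF r_deriv_deriv]) simp
  note deriv = nth_deriv_on_eqI[where G = "r_deriv n" and m = k, OF nontriv r0 rd]
  have "completely_monotonic_of_order (real k) (logGamma_rem n)"
    unfolding completely_monotonic_of_order_def
  proof (rule completely_monotonic_laplace[OF subexp_r_deriv])
    show "x powr real k * logGamma_rem n x = laplace (r_deriv n k) x" if "0 < x" for x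
      using that assms by (simp add: laplace_r_deriv powr_realpow)
  qed (use assms r_deriv_nonneg in blast)
  moreover have "((\<lambda>t. exp (- x * t) * r_fun n t) has_integral logGamma_rem n x) {0..}" if "0 < x" for x
  proof (rule has_integral_eq)
    show "((\<lambda>t. exp (- x * t) * r_deriv n 0 t) has_integral logGamma_rem n x) {0..}"
      using laplace_has_integral[OF subexp_r_deriv[of n 0] that] laplace_r_deriv[OF that, of 0 n] by simp
  qed (simp add: r0)
  moreover have "nth_deriv_on {0..} l (r_fun n) 0 = 0" if "l < k" for l
    using that assms deriv(1)[of l 0] by (simp add: r_deriv_0)
  moreover have "0 < nth_deriv_on {0..} k (r_fun n) t" if "0 < t" for t
    using that assms deriv(1)[of k t] by (simp add: r_deriv_pos)
  ultimately show ?thesis using deriv(2) by blast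
qed

end
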